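(* Assume Cardy's formula: for every $\rho>0$, $$F_0(\rho)=6\pi\,\frac{\sum_{k\in\mathbb Z}(-1)^{k-1}k\,q^{3k^2/2-k+1/8}}{\prod_{k=1}^{\infty}(1-q^k)},\qquad q=\exp(-2\pi^2/\rho),$$ where $F_0(\rho):=\mu_0\bigl(\mathrm{Loop}^1(\{1<|z|<e^{\rho}\})\bigr)$. Then for every $r>0$, with $C_r:=\{z\in\mathbb C: |z|=r\}$, $$\mu_0\bigl(\{\gamma\in \mathrm{Loop}^1(\mathbb C^{\times}) : \gamma\cap C_r\neq\emptyset\}\bigr)=\frac{2\pi}{\sqrt 3}.$$
   Context: For a topological space $S$, $\mathrm{Comp}(S)$ is the set of compact subsets of $S$ with the Vietoris topology, and $\mathrm{Loop}(S)=\{\gamma\in\mathrm{Comp}(S): \gamma \text{ is homeomorphic to } S^1\}$ with the induced topology. For $S\subset\mathbb C^\times:=\mathbb C\setminus\{0\}$, $\mathrm{Loop}^1(S)$ is the set of loops in $\mathrm{Loop}(S)$ which surround $0$. A family $\{\mu_S\}$, with $\mu_S$ a positive Borel measure on $\mathrm{Loop}(S)$ for each Riemann surface $S$, satisfies conformal restriction if for every conformal embedding $S_1\to S_2$ the restriction of $\mu_{S_2}$ to $\mathrm{Loop}(S_1)$ equals $\mu_{S_1}$ (with $S_1$ identified with its image). Werner's theorem (known, may be assumed): there is a nontrivial family of locally finite measures satisfying conformal restriction, unique up to an overall positive constant. Let $\mu_0$ denote the restriction of this measure (for the plane) to $\mathrm{Loop}^1(\mathbb C^\times)$. The constant is fixed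 by Werner's formula (known, may be assumed): if $U,V$ are simply connected domains with $0\in U\subset V\subsetneq\mathbb C$, and $\phi:(U,0)\to(V,0)$ is a conformal isomorphism, then $$\mu_0\bigl(\mathrm{Loop}^1(V\setminus\{0\})\setminus\mathrm{Loop}(U)\bigr)=\log|\phi'(0)|.$$ *)

theory Defs
  imports "HOL-Analysis.Analysis"
begin

definition vietoris :: "'a topology \<Rightarrow> 'a set topology" where
  "vietoris X = topology_generated_by
     ({{K. compactin X K \<and> K \<subseteq> U} | U. openin X U} \<union>
      {{K. compactin X K \<and> K \<inter> U \<noteq> {}} | U. openin X U})"

definition Loop :: "'a topology \<Rightarrow> 'a set set" where
  "Loop X = {\<gamma>. compactin X \<gamma> \<and>
     subtopology X \<gamma> homeomorphic_space top_of_set (sphere (0::complex) 1)}"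

definition loop_topology :: "'a topology \<Rightarrow> 'a set topology" where
  "loop_topology X = subtopology (vietoris X) (Loop X)"

definition Loop1 :: "complex set \<Rightarrow> complex set set" where
  "Loop1 S = {\<gamma> \<in> Loop (top_of_set S). 0 \<in> inside \<gamma>}"

definition borel_of :: "'a topology \<Rightarrow> 'a measure" where
  "borel_of X = sigma (topspace X) {U. openin X U}"

text \<open>A chart is a pair \<open>(U, \<phi>)\<close> of a coordinate domain and a coordinate map; the values of
  \<open>\<phi>\<close> outside \<open>U\<close> are irrelevant.  Second countability of a Riemann surface is not required
  separately, since it is automatic for connected surfaces (Rado).\<close>

record 'a surface =
  surf_top :: "'a topology"
  charts :: "('a set \<times> ('a \<Rightarrow> complex)) set"

definition riemann_surface :: "'a surface \<Rightarrow> bool" where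
  "riemann_surface S \<longleftrightarrow>
     Hausdorff_space (surf_top S) \<and> connected_space (surf_top S) \<and> topspace (surf_top S) \<noteq> {} \<and>
     (\<forall>(U, \<phi>) \<in> charts S. openin (surf_top S) U \<and> open (\<phi> ` U) \<and>
        homeomorphic_map (subtopology (surf_top S) U) (top_of_set (\<phi> ` U)) \<phi>) \<and>
     (\<Union>(U, \<phi>) \<in> charts S. U) = topspace (surf_top S) \<and>
     (\<forall>(U, \<phi>) \<in> charts S. \<forall>(V, \<psi>) \<in> charts S.
        (\<psi> \<circ> inv_into U \<phi>) holomorphic_on \<phi> ` (U \<inter> V))"

definition plane :: "complex surface" where
  "plane = \<lparr>surf_top = euclidean, charts = {(UNIV, id)}\<rparr>"

definition conformal_embedding :: "'a surface \<Rightarrow> 'b surface \<Rightarrow> ('a \<Rightarrow> 'b) \<Rightarrow> bool" where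
  "conformal_embedding S T f \<longleftrightarrow>
     continuous_map (surf_top S) (surf_top T) f \<and> inj_on f (topspace (surf_top S)) \<and>
     (\<forall>(U, \<phi>) \<in> charts S. \<forall>(V, \<psi>) \<in> charts T.
        (\<psi> \<circ> f \<circ> inv_into U \<phi>) holomorphic_on \<phi> ` (U \<inter> f -` V))"

text \<open>A family is a function on surfaces, whose values are only relevant at Riemann surfaces.
  Every Riemann surface has the cardinality of the continuum, hence is isomorphic to one whose
  underlying set consists of complex numbers (with an arbitrary topology and complex structure);
  so at type \<open>'a = complex\<close> the notions below range over all Riemann surfaces up to isomorphism.\<close>

definition loop_measure_family :: "('a surface \<Rightarrow> 'a set measure) \<Rightarrow> bool" where
  "loop_measure_family \<mu> \<longleftrightarrow>
     (\<forall>S. riemann_surface S \<longrightarrow>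
        space (\<mu> S) = Loop (surf_top S) \<and>
        sets (\<mu> S) = sets (borel_of (loop_topology (surf_top S))))"

text \<open>A conformal embedding \<open>f\<close> is a homeomorphism onto an open subset, so \<open>\<gamma> \<mapsto> f ` \<gamma>\<close> maps the
  Borel sets of the loop space of \<open>S\<close> bijectively onto the Borel sets of loops in \<open>T\<close> that
  are contained in the image of \<open>f\<close>.\<close>

definition conformal_restriction :: "('a surface \<Rightarrow> 'a set measure) \<Rightarrow> bool" where
  "conformal_restriction \<mu> \<longleftrightarrow>
     (\<forall>S T f. riemann_surface S \<and> riemann_surface T \<and> conformal_embedding S T f \<longrightarrow>
        (\<forall>A \<in> sets (\<mu> S). emeasure (\<mu> T) ((\<lambda>\<gamma>. f ` \<gamma>) ` A) = emeasure (\<mu> S) A))"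

definition locally_finite_family :: "('a surface \<Rightarrow> 'a set measure) \<Rightarrow> bool" where
  "locally_finite_family \<mu> \<longleftrightarrow>
     (\<forall>S. riemann_surface S \<longrightarrow>
        (\<forall>\<gamma> \<in> Loop (surf_top S). \<exists>N. openin (loop_topology (surf_top S)) N \<and> \<gamma> \<in> N \<and>
           emeasure (\<mu> S) N < \<infinity>))"

definition nontrivial_family :: "('a surface \<Rightarrow> 'a set measure) \<Rightarrow> bool" where
  "nontrivial_family \<mu> \<longleftrightarrow> (\<exists>S. riemann_surface S \<and> emeasure (\<mu> S) (space (\<mu> S)) \<noteq> 0)"

definition mu0 :: "(complex surface \<Rightarrow> complex set measure) \<Rightarrow> complex set measure" where
  "mu0 \<mu> = restrict_space (\<mu> plane) (Loop1 (UNIV - {0}))"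

definition werner_formula :: "(complex surface \<Rightarrow> complex set measure) \<Rightarrow> bool" where
  "werner_formula \<mu> \<longleftrightarrow>
     (\<forall>U V \<phi>. open U \<and> simply_connected U \<and> open V \<and> simply_connected V \<and>
        0 \<in> U \<and> U \<subseteq> V \<and> V \<noteq> UNIV \<and>
        \<phi> holomorphic_on U \<and> bij_betw \<phi> U V \<and> \<phi> 0 = 0 \<longrightarrow>
        emeasure (mu0 \<mu>) (Loop1 (V - {0}) - Loop (top_of_set U)) =
          ennreal (ln (cmod (deriv \<phi> 0))))"

text \<open>A family as in Werner's theorem; the last condition fixes the multiplicative constant.\<close>

definition werner_family :: "(complex surface \<Rightarrow> complex set measure) \<Rightarrow> bool" where
  "werner_family \<mu> \<longleftrightarrow>
     loop_measure_family \<mu> \<and> locally_finite_family \<mu> \<and> nontrivial_family \<mu> \<and>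
     conformal_restriction \<mu> \<and> werner_formula \<mu>"

definition F0 :: "(complex surface \<Rightarrow> complex set measure) \<Rightarrow> real \<Rightarrow> ennreal" where
  "F0 \<mu> \<rho> = emeasure (mu0 \<mu>) (Loop1 {z. 1 < cmod z \<and> cmod z < exp \<rho>})"

definition cardy :: "real \<Rightarrow> real" where
  "cardy \<rho> = (let q = exp (- 2 * pi\<^sup>2 / \<rho>) in
     6 * pi *
     ((\<Sum>\<^sub>\<infinity>k::int. (-1) powi (k - 1) * of_int k * q powr (3 * (of_int k)\<^sup>2 / 2 - of_int k + 1 / 8)) /
      (\<Prod>k. 1 - q ^ Suc k)))"

end

theory Submission
  imports Defs "HOL-Probability.Probability"
begin

text \<open>Let \<open>R = exp \<rho>\<close>.  By Werner's formula for the discs of radius \<open>1\<close> and \<open>R\<close>, loops around \<open>0\<close> in the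
  large disc which are not contained in the small one have mass \<open>\<rho>\<close>.  Such a loop either stays in the
  annulus or meets the unit circle, so loops in the large disc meeting the unit circle have mass
  \<open>\<rho> - F0 \<rho>\<close>, and the answer is the limit of this as \<open>\<rho> \<rightarrow> \<infinity>\<close>; scale invariance gives all radii.

  The limit is taken at \<open>q \<rightarrow> 1\<close>.  Completing squares, and using Euler's pentagonal number theorem for the
  denominator, Cardy's formula becomes a ratio of values of
  \<open>\<Theta>(x) = \<Sum>k\<in>\<int>. (-1)^k exp (- pi t (x - k)^2)\<close> with \<open>t = 3 pi / \<rho>\<close>, namely
  \<open>- 6 pi (\<Theta>(1/3) / 3 + \<Theta>'(1/3) / (2 pi t)) / \<Theta>(1/6)\<close>.  Poisson summation turns \<open>sqrt t * \<Theta>\<close> into a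
  cosine series whose first term dominates as \<open>t \<rightarrow> 0\<close>, which gives \<open>\<rho> - 2 pi / sqrt 3 + o(1)\<close>.\<close>

text \<open>The fraction is compared with \<open>\<rho>\<close> itself, so it must be known up to
  \<open>o(1)\<close>, although numerator and denominator both degenerate as \<open>q\<close> tends
  to 1. After inversion the leading terms are \<open>2 cos (pi/3) = 1\<close>, its derivative
  \<open>- 2 pi sin (pi/3) = - pi sqrt 3\<close>, and \<open>2 cos (pi/6) = sqrt 3\<close>. The
  derivative enters with weight \<open>\<rho> / (6 pi^2)\<close>, and
  \<open>sin (pi/3) = cos (pi/6)\<close> makes its contribution exactly \<open>\<rho>\<close>; what
  remains is \<open>2 pi cos (pi/3) / cos (pi/6) = 2 pi / sqrt 3\<close>. All corrections are
  \<open>O(exp (- \<rho> / 3))\<close>, small enough to survive a factor \<open>\<rho>\<close>.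
  Poisson summation comes from comparing Fourier coefficients: \<open>\<Theta>\<close> changes sign
  under a unit shift, so a twist by \<open>cis (- pi x)\<close> makes both sides 1-periodic, and
  unfolding turns the coefficients of \<open>\<Theta>\<close> into Gaussian integrals over the
  line.\<close>

section \<open>The pentagonal number theorem\<close>

text \<open>D. Shanks, A short proof of an identity of Euler (1951): a finite form of the theorem, whose
  terms with \<open>s > 0\<close> on the left disappear in the limit.\<close>

lemma shanks_identity:
  fixes q :: real
  assumes q: "0 < q" "q < 1"
  defines "P \<equiv> \<lambda>n. \<Prod>k<n. 1 - q ^ Suc k" and "t \<equiv> \<lambda>n::nat. \<Sum>{..<n}"
  shows "(\<Sum>s\<le>n. (- 1) ^ s * (P n / P s) * q ^ (s * n + t s + s)) =
         (\<Sum>i<n. (- 1) ^ i * (q ^ (i * i + t i) - q ^ (Suc i * Suc i + t (Suc i) + Suc i))) + (- 1) ^ n * q ^ (n * n + t n)"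
proof (induction n)
  case 0
  show ?case by (simp add: t_def P_def)
next
  case (Suc n)
  have P: "P m \<noteq> 0" for m
    unfolding P_def using q power_Suc_less_one[of q] by (auto simp: order.strict_iff_order)
  define c where "c = (\<lambda>s. (- 1) ^ s * (P n / P s) * q ^ (s * n + t s + s))"
  \<comment> \<open>\<open>g\<close> is a telescoping certificate: \<open>g1\<close> and
    \<open>g2\<close> express both corrections to \<open>c s\<close> through it. Passing from
    \<open>n\<close> to \<open>n + 1\<close> multiplies \<open>c s\<close> by
    \<open>q ^ s * (1 - q ^ Suc n)\<close>, which amounts to adding \<open>g s - g (Suc s)\<close>,
    so only boundary terms survive the sum.\<close>
  define g where "g = (\<lambda>s. case s of 0 \<Rightarrow> 0 | Suc s' \<Rightarrow> (- 1) ^ s' * (P n / P s') * q ^ (s * n + t s + s))"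
  have tS: "t (Suc m) = t m + m" for m by (simp add: t_def)
  have PS: "P (Suc m) = P m * (1 - q ^ Suc m)" for m by (simp add: P_def)
  have g1: "c s * (q ^ s - 1) = g s" for s
  proof (cases s)
    case (Suc m)
    have "1 - q ^ Suc m \<noteq> 0" using P[of "Suc m"] PS by auto
    then have "(P n / (P m * (1 - q ^ Suc m))) * (q ^ Suc m - 1) = - (P n / P m)"
      using P[of m] by (simp add: field_simps del: power_Suc)
    moreover have "c s * (q ^ s - 1) = (- 1) ^ Suc m * q ^ (s * n + t s + s) *
        ((P n / (P m * (1 - q ^ Suc m))) * (q ^ Suc m - 1))"
      unfolding c_def PS Suc by (simp only: mult_ac)
    ultimately show ?thesis
      by (simp add: g_def Suc)
  qed (simp add: g_def)
  have g2: "c s * q ^ s * q ^ Suc n = g (Suc s)" for s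
    by (simp add: c_def g_def tS flip: power_add) (simp add: algebra_simps flip: power_add power_Suc)
  have "(\<Sum>s\<le>Suc n. (- 1) ^ s * (P (Suc n) / P s) * q ^ (s * Suc n + t s + s)) =
        (- 1) ^ Suc n * q ^ (Suc n * Suc n + t (Suc n) + Suc n)
        + (\<Sum>s\<le>n. c s * q ^ s * (1 - q ^ Suc n))"
  proof -
    have "(- 1) ^ s * (P (Suc n) / P s) * q ^ (s * Suc n + t s + s) = c s * q ^ s * (1 - q ^ Suc n)" for s
      unfolding PS c_def by (simp add: power_add)
    then have "(\<Sum>s\<le>n. (- 1) ^ s * (P (Suc n) / P s) * q ^ (s * Suc n + t s + s)) = (\<Sum>s\<le>n. c s * q ^ s * (1 - q ^ Suc n))"
      by (intro sum.cong refl)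
    moreover have "P (Suc n) / P (Suc n) = 1" using P by simp
    ultimately show ?thesis by (simp only: sum.atMost_Suc add.commute mult_1_right)
  qed
  also have "(\<Sum>s\<le>n. c s * q ^ s * (1 - q ^ Suc n)) = (\<Sum>s\<le>n. c s + (g s - g (Suc s)))"
  proof (intro sum.cong refl)
    fix s
    have "c s + (g s - g (Suc s)) = c s + (c s * (q ^ s - 1) - c s * q ^ s * q ^ Suc n)"
      by (simp only: g1 g2)
    then show "c s * q ^ s * (1 - q ^ Suc n) = c s + (g s - g (Suc s))"
      by (simp only: ring_distribs)
  qed
  also have "\<dots> = (\<Sum>s\<le>n. c s) + (g 0 - g (Suc n))"
    by (simp only: sum.distrib sum_telescope)
  also have "g 0 - g (Suc n) = (- 1) ^ Suc n * q ^ (Suc n * Suc n + t (Suc n))"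
    using P[of n] by (simp add: g_def tS algebra_simps)
  finally show ?case
    using Suc.IH by (simp add: c_def algebra_simps)
qed

text \<open>This is the limit of \<open>shanks_identity\<close>. The term \<open>s = 0\<close> is
  the partial product; each of the \<open>n\<close> others is at most \<open>q ^ n\<close>, because
  the partial products decrease and the exponent contains \<open>s * n\<close>, and
  \<open>n * q ^ n\<close> tends to 0. The second exponent is the pentagonal number
  \<open>k (3 k - 1) / 2\<close> at \<open>k = - (n + 1)\<close>, so a pair runs through
  \<open>k = n\<close> and \<open>k = - n - 1\<close>.\<close>

lemma pentagonal_number_theorem:
  fixes q :: real
  assumes q: "0 < q" "q < 1"
  shows "(\<lambda>n. (- 1) ^ n * (q powr (real n * (3 * real n - 1) / 2) - q powr ((real n + 1) * (3 * real n + 4) / 2)))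
           sums (\<Prod>k. 1 - q ^ Suc k)"
proof -
  define P where "P = (\<lambda>n. \<Prod>k<n. 1 - q ^ Suc k)"
  define t where "t = (\<lambda>n::nat. \<Sum>{..<n})"
  have Ppos: "P m > 0" for m
    unfolding P_def using q by (intro prod_pos) (simp add: power_Suc_less_one del: power_Suc)
  have Pmono: "P n \<le> P s" if "s \<le> n" for s n
    using that
  proof (induction rule: dec_induct)
    case (step m)
    have "P (Suc m) \<le> P m * 1"
      unfolding P_def prod.lessThan_Suc using q Ppos[of m, unfolded P_def]
      by (intro mult_left_mono) auto
    with step show ?case by simp
  qed simp
  have P_lim: "P \<longlonglongrightarrow> (\<Prod>k. 1 - q ^ Suc k)"
  proof -
    have "summable (\<lambda>k. q ^ Suc k)"
      using q by (intro summable_ignore_initial_segment[of _ 1, simplified] summable_geometric) auto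
    then have "abs_convergent_prod (\<lambda>k. 1 - q ^ Suc k)"
      using q by (intro summable_imp_abs_convergent_prod) (simp add: abs_mult power_abs)
    then have "convergent_prod (\<lambda>k. 1 - q ^ Suc k)"
      by (rule abs_convergent_prod_imp_convergent_prod)
    then show ?thesis
      unfolding P_def LIMSEQ_lessThan_iff_atMost by (rule convergent_prod_LIMSEQ)
  qed
  have nqn: "(\<lambda>n. real n * q ^ n) \<longlonglongrightarrow> 0"
    using q by (intro powser_times_n_limit_0) auto
  have tail: "(\<lambda>n. \<Sum>s=1..n. (- 1) ^ s * (P n / P s) * q ^ (s * n + t s + s)) \<longlonglongrightarrow> 0"
  proof (rule Lim_null_comparison[OF always_eventually nqn], intro allI)
    fix n
    have "\<bar>(- 1) ^ s * (P n / P s) * q ^ (s * n + t s + s)\<bar> \<le> q ^ n" if "s \<in> {1..n}" for s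
    proof -
      have "P n / P s \<le> 1" "P n / P s \<ge> 0"
        using Pmono[of s n] that Ppos[of s] Ppos[of n] by auto
      moreover have "q ^ (s * n + t s + s) \<le> q ^ n"
        using q that by (intro power_decreasing) (auto simp: Suc_le_eq trans_le_add1)
      ultimately have "(P n / P s) * q ^ (s * n + t s + s) \<le> 1 * q ^ n"
        using q by (intro mult_mono) auto
      then show ?thesis
        using q Ppos[of s] Ppos[of n] by (simp add: abs_mult power_abs)
    qed
    then have "\<bar>\<Sum>s=1..n. (- 1) ^ s * (P n / P s) * q ^ (s * n + t s + s)\<bar> \<le> (\<Sum>s=1..n. q ^ n)"
      by (rule order_trans[OF sum_abs sum_mono])
    then show "norm (\<Sum>s=1..n. (- 1) ^ s * (P n / P s) * q ^ (s * n + t s + s)) \<le> real n * q ^ n"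
      by simp
  qed
  have last: "(\<lambda>n. (- 1) ^ n * q ^ (n * n + t n)) \<longlonglongrightarrow> 0"
  proof (rule Lim_null_comparison[OF always_eventually LIMSEQ_power_zero[of q]], intro allI)
    show "norm ((- 1) ^ n * q ^ (n * n + t n)) \<le> q ^ n" for n
      using q by (auto simp: abs_mult power_abs intro!: power_decreasing) (metis le_square trans_le_add1)
  qed (use q in auto)
  have split: "(\<Sum>s\<le>n. (- 1) ^ s * (P n / P s) * q ^ (s * n + t s + s)) =
      P n + (\<Sum>s=1..n. (- 1) ^ s * (P n / P s) * q ^ (s * n + t s + s))" for n
    unfolding atMost_atLeast0 by (subst sum.atLeast_Suc_atMost) (auto simp: P_def t_def)
  have "(\<lambda>n. P n + (\<Sum>s=1..n. (- 1) ^ s * (P n / P s) * q ^ (s * n + t s + s)) - (- 1) ^ n * q ^ (n * n + t n))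
          \<longlonglongrightarrow> (\<Prod>k. 1 - q ^ Suc k) + 0 - 0"
    by (intro tendsto_intros P_lim tail last)
  also have "(\<lambda>n. P n + (\<Sum>s=1..n. (- 1) ^ s * (P n / P s) * q ^ (s * n + t s + s)) - (- 1) ^ n * q ^ (n * n + t n)) =
     (\<lambda>n. \<Sum>i<n. (- 1) ^ i * (q ^ (i * i + t i) - q ^ (Suc i * Suc i + t (Suc i) + Suc i)))"
    unfolding split[symmetric] unfolding P_def t_def shanks_identity[OF q] by simp
  also have "\<dots> = (\<lambda>n. \<Sum>i<n. (- 1) ^ i * (q powr (real i * (3 * real i - 1) / 2) - q powr ((real i + 1) * (3 * real i + 4) / 2)))"
  proof -
    have t: "real (t m) = real m * (real m - 1) / 2" for m
      by (induction m) (auto simp: t_def field_simps)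
    have e1: "real (i * i + t i) = real i * (3 * real i - 1) / 2"
      and e2: "real (Suc i * Suc i + t (Suc i) + Suc i) = (real i + 1) * (3 * real i + 4) / 2" for i
      unfolding of_nat_add of_nat_mult t by (simp_all add: field_simps)
    show ?thesis
      by (simp only: e1 e2 flip: powr_realpow[OF q(1)])
  qed
  finally show ?thesis by (simp add: sums_def)
qed

section \<open>Uniqueness of Fourier coefficients\<close>

lemma has_integral_cis_unit:
  fixes k :: int
  shows "((\<lambda>x. cis (2 * pi * of_int k * x)) has_integral (if k = 0 then 1 else 0)) {0..1::real}"
proof (cases "k = 0")
  case True
  then show ?thesis using has_integral_const_real[of "1::complex" 0 1] by simp
next
  case False
  define w where "w = 2 * pi * of_int k"
  have w: "w \<noteq> 0" using False by (simp add: w_def)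
  define F where "F = (\<lambda>x. cis (w * x) / (\<i> * of_real w))"
  have "((\<lambda>x. cis (w * x)) has_integral F 1 - F 0) {0..1}"
  proof (rule fundamental_theorem_of_calculus)
    show "(F has_vector_derivative cis (w * x)) (at x within {0..1})" for x
    proof -
      have "((\<lambda>z. exp (\<i> * of_real w * z) / (\<i> * of_real w)) has_field_derivative exp (\<i> * of_real w * of_real x)) (at (of_real x))"
        using w by (auto intro!: derivative_eq_intros)
      from has_vector_derivative_real_field[OF this] show ?thesis
        by (simp add: F_def cis_conv_exp mult.assoc)
    qed
  qed simp
  moreover have "F 1 - F 0 = 0"
    using cis_multiple_2pi[of "of_int k"] by (simp add: F_def w_def)
  ultimately show ?thesis using False by (simp add: w_def)
qed

text \<open>The integral of \<open>|h - s|^2\<close> is nonnegative, where \<open>s\<close> is the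
  partial Fourier sum over \<open>S\<close>. By orthonormality both cross terms and the square of
  \<open>s\<close> integrate to the same number \<open>B\<close>, so the expansion leaves the
  integral of \<open>|h|^2\<close> minus \<open>B\<close>.\<close>

lemma bessel_inequality:
  fixes h :: "real \<Rightarrow> complex" and S :: "int set"
  assumes h: "continuous_on {0..1} h" and S: "finite S"
  defines "c \<equiv> \<lambda>n. integral {0..1} (\<lambda>x. h x * cis (- (2 * pi * of_int n * x)))"
  shows "(\<Sum>n\<in>S. (norm (c n))\<^sup>2) \<le> integral {0..1} (\<lambda>x. (norm (h x))\<^sup>2)"
proof -
  let ?e = "\<lambda>n x. cis (2 * pi * of_int n * x)"
  define s where "s = (\<lambda>x. \<Sum>n\<in>S. c n * ?e n x)"
  define B where "B = (\<Sum>n\<in>S. c n * cnj (c n))"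
  have c: "((\<lambda>x. h x * cnj (?e n x)) has_integral c n) {0..1}" for n
    unfolding c_def cis_cnj
    by (intro integrable_integral integrable_continuous_interval continuous_intros h)
  have c': "((\<lambda>x. ?e n x * cnj (h x)) has_integral cnj (c n)) {0..1}" for n
    using c[of n] unfolding has_integral_cnj[symmetric, of "\<lambda>x. h x * _ x"] by (simp add: o_def mult.commute)
  have e: "((\<lambda>x. ?e n x * cnj (?e m x)) has_integral (if n = m then 1 else 0)) {0..1}" for n m
    using has_integral_cis_unit[of "n - m"] by (simp add: cis_cnj cis_mult algebra_simps)
  have hh: "((\<lambda>x. h x * cnj (h x)) has_integral of_real (integral {0..1} (\<lambda>x. (norm (h x))\<^sup>2))) {0..1}"
    unfolding complex_norm_square[symmetric]
    by (intro has_integral_of_real integrable_integral integrable_continuous_interval continuous_intros h)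
  have hs: "((\<lambda>x. \<Sum>n\<in>S. cnj (c n) * (h x * cnj (?e n x))) has_integral (\<Sum>n\<in>S. cnj (c n) * c n)) {0..1}"
    by (intro has_integral_sum S has_integral_mult_right c)
  have sh: "((\<lambda>x. \<Sum>n\<in>S. c n * (?e n x * cnj (h x))) has_integral (\<Sum>n\<in>S. c n * cnj (c n))) {0..1}"
    by (intro has_integral_sum S has_integral_mult_right c')
  have ss: "((\<lambda>x. \<Sum>n\<in>S. \<Sum>m\<in>S. c n * cnj (c m) * (?e n x * cnj (?e m x))) has_integral
      (\<Sum>n\<in>S. \<Sum>m\<in>S. c n * cnj (c m) * (if n = m then 1 else 0))) {0..1}"
    by (intro has_integral_sum S has_integral_mult_right e)
  have "((\<lambda>x. h x * cnj (h x) - (\<Sum>n\<in>S. cnj (c n) * (h x * cnj (?e n x)))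
        - (\<Sum>n\<in>S. c n * (?e n x * cnj (h x)))
        + (\<Sum>n\<in>S. \<Sum>m\<in>S. c n * cnj (c m) * (?e n x * cnj (?e m x)))) has_integral
      of_real (integral {0..1} (\<lambda>x. (norm (h x))\<^sup>2)) - (\<Sum>n\<in>S. cnj (c n) * c n) - (\<Sum>n\<in>S. c n * cnj (c n))
      + (\<Sum>n\<in>S. \<Sum>m\<in>S. c n * cnj (c m) * (if n = m then 1 else 0))) {0..1}"
    by (intro has_integral_add has_integral_diff hh hs sh ss)
  moreover have "h x * cnj (h x) - (\<Sum>n\<in>S. cnj (c n) * (h x * cnj (?e n x)))
        - (\<Sum>n\<in>S. c n * (?e n x * cnj (h x)))
        + (\<Sum>n\<in>S. \<Sum>m\<in>S. c n * cnj (c m) * (?e n x * cnj (?e m x))) = of_real ((norm (h x - s x))\<^sup>2)" for x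
  proof -
    have "of_real ((norm (h x - s x))\<^sup>2) = h x * cnj (h x) - h x * cnj (s x) - s x * cnj (h x) + s x * cnj (s x)"
      unfolding complex_norm_square by (simp add: algebra_simps)
    moreover have "h x * cnj (s x) = (\<Sum>n\<in>S. cnj (c n) * (h x * cnj (?e n x)))"
      by (simp add: s_def sum_distrib_left mult_ac)
    moreover have "s x * cnj (h x) = (\<Sum>n\<in>S. c n * (?e n x * cnj (h x)))"
      by (simp only: s_def sum_distrib_right mult.assoc)
    moreover have "s x * cnj (s x) = (\<Sum>n\<in>S. \<Sum>m\<in>S. c n * cnj (c m) * (?e n x * cnj (?e m x)))"
      by (simp add: s_def sum_product mult_ac)
    ultimately show ?thesis by simp
  qed
  moreover have "(\<Sum>n\<in>S. \<Sum>m\<in>S. c n * cnj (c m) * (if n = m then 1 else 0)) = B"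
    using S by (simp add: B_def if_distrib sum.delta cong: if_cong)
  moreover have "(\<Sum>n\<in>S. cnj (c n) * c n) = B"
    by (simp add: B_def mult.commute)
  ultimately have "((\<lambda>x. complex_of_real ((norm (h x - s x))\<^sup>2)) has_integral
      of_real (integral {0..1} (\<lambda>x. (norm (h x))\<^sup>2)) - B) {0..1}"
    by (simp add: B_def)
  from has_integral_Re[OF this]
  have "((\<lambda>x. (norm (h x - s x))\<^sup>2) has_integral integral {0..1} (\<lambda>x. (norm (h x))\<^sup>2) - Re B) {0..1}"
    by simp
  then have "0 \<le> integral {0..1} (\<lambda>x. (norm (h x))\<^sup>2) - Re B"
    by (rule has_integral_nonneg) simp
  moreover have "B = of_real (\<Sum>n\<in>S. (norm (c n))\<^sup>2)"
    unfolding B_def of_real_sum complex_norm_square ..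
  ultimately show ?thesis by simp
qed

lemma has_vector_derivative_slope:
  fixes f :: "real \<Rightarrow> 'a::real_normed_vector"
  assumes "(f has_vector_derivative d) (at x)"
  shows "((\<lambda>y. (f y - f x) /\<^sub>R (y - x)) \<longlongrightarrow> d) (at x)"
proof -
  have "((\<lambda>y. norm ((f y - f x) - (y - x) *\<^sub>R d) / norm (y - x)) \<longlongrightarrow> 0) (at x)"
    using assms unfolding has_vector_derivative_def has_derivative_iff_norm by simp
  then have "((\<lambda>y. norm ((f y - f x) /\<^sub>R (y - x) - d)) \<longlongrightarrow> 0) (at x)"
  proof (rule Lim_transform_within[where d = 1])
    fix y assume "0 < dist y x"
    then have "(f y - f x) /\<^sub>R (y - x) - d = ((f y - f x) - (y - x) *\<^sub>R d) /\<^sub>R (y - x)"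
      by (simp add: scaleR_diff_right)
    then show "norm ((f y - f x) - (y - x) *\<^sub>R d) / norm (y - x) = norm ((f y - f x) /\<^sub>R (y - x) - d)"
      by (simp add: divide_inverse mult.commute)
  qed simp
  then show ?thesis
    by (simp only: tendsto_norm_zero_iff LIM_zero_iff)
qed

text \<open>Chernoff's argument: dividing \<open>D - D x\<^sub>0\<close> by \<open>cis (2 * pi * (x - x\<^sub>0)) - 1\<close> gives a continuous
  function whose Fourier coefficients have constant modulus on either side of a jump of size \<open>D x\<^sub>0\<close>,
  which by Bessel's inequality forces them to vanish.\<close>

lemma fourier_coefficients_zero:
  fixes D :: "real \<Rightarrow> complex"
  assumes cont: "continuous_on {0..1} D" and x0: "0 < x0" "x0 < 1"
    and diff: "(D has_vector_derivative d) (at x0)"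
    and coeff: "\<And>n::int. integral {0..1} (\<lambda>x. D x * cis (- (2 * pi * of_int n * x))) = 0"
  shows "D x0 = 0"
proof -
  \<comment> \<open>The value at \<open>x0\<close> is the limit of the quotient: the derivative of
    the numerator over that of the denominator.\<close>
  define h where "h = (\<lambda>x. if x = x0 then d / (2 * pi * \<i>) else (D x - D x0) / (cis (2 * pi * (x - x0)) - 1))"
  \<comment> \<open>As \<open>x0\<close> is an interior point, no point of the interval is at
    distance 1 or more from it, so the denominator has no second zero.\<close>
  have ne: "cis (2 * pi * (x - x0)) \<noteq> 1" if "x \<in> {0..1}" "x \<noteq> x0" for x
  proof
    assume "cis (2 * pi * (x - x0)) = 1"
    then have "cos (2 * pi * (x - x0)) = 1" by (simp add: complex_eq_iff)
    then obtain k :: int where "2 * pi * (x - x0) = of_int k * 2 * pi"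
      unfolding cos_one_2pi_int by blast
    then have "x - x0 = of_int k" by simp
    moreover have "\<bar>x - x0\<bar> < 1" using that x0 by auto
    ultimately have "k = 0" by linarith
    with \<open>x - x0 = of_int k\<close> that show False by simp
  qed
  have "continuous_on {0..1} h"
    unfolding continuous_on_eq_continuous_within
  proof
    fix x :: real assume x: "x \<in> {0..1}"
    show "continuous (at x within {0..1}) h"
    proof (cases "x = x0")
      case True
      have 1: "((\<lambda>y. (D y - D x0) /\<^sub>R (y - x0)) \<longlongrightarrow> d) (at x0)"
        by (rule has_vector_derivative_slope[OF diff])
      have "((\<lambda>y. cis (2 * pi * (y - x0))) has_vector_derivative 2 * pi * \<i>) (at x0)"
      proof -
        have "((\<lambda>z. exp (\<i> * of_real (2 * pi) * (z - of_real x0))) has_field_derivative 2 * pi * \<i>) (at (of_real x0))"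
          by (auto intro!: derivative_eq_intros)
        from has_vector_derivative_real_field[OF this] show ?thesis
          by (simp add: cis_conv_exp mult.assoc)
      qed
      from has_vector_derivative_slope[OF this]
      have 2: "((\<lambda>y. (cis (2 * pi * (y - x0)) - 1) /\<^sub>R (y - x0)) \<longlongrightarrow> 2 * pi * \<i>) (at x0)"
        by simp
      have "((\<lambda>y. ((D y - D x0) /\<^sub>R (y - x0)) / ((cis (2 * pi * (y - x0)) - 1) /\<^sub>R (y - x0))) \<longlongrightarrow> d / (2 * pi * \<i>)) (at x0 within {0..1})"
        by (intro tendsto_divide tendsto_within_subset[OF 1] tendsto_within_subset[OF 2]) auto
      then have "(h \<longlongrightarrow> d / (2 * pi * \<i>)) (at x0 within {0..1})"
        by (rule Lim_transform_within[where d = 1]) (auto simp: h_def scaleR_conv_of_real divide_simps)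
      then show ?thesis
        unfolding True continuous_within by (simp add: h_def)
    next
      case False
      have "continuous (at x within {0..1}) (\<lambda>x. (D x - D x0) / (cis (2 * pi * (x - x0)) - 1))"
      proof (intro continuous_intros)
        have "continuous_on {0..1} (\<lambda>x. cis (2 * pi * (x - x0)))" by (intro continuous_intros)
        with cont x show "continuous (at x within {0..1}) D" "continuous (at x within {0..1}) (\<lambda>x. cis (2 * pi * (x - x0)))"
          by (simp_all add: continuous_on_eq_continuous_within)
      qed (use ne[OF x False] in simp)
      then show ?thesis
        by (rule continuous_transform_within[where \<delta> = "dist x x0"])
           (use x False in \<open>auto simp: h_def dist_commute\<close>)
    qed
  qed
  define c where "c = (\<lambda>n::int. integral {0..1} (\<lambda>x. h x * cis (- (2 * pi * of_int n * x))))"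
  have c: "((\<lambda>x. h x * cis (- (2 * pi * of_int n * x))) has_integral c n) {0..1}" for n
    unfolding c_def
    by (intro integrable_integral integrable_continuous_interval continuous_intros \<open>continuous_on {0..1} h\<close>)
  \<comment> \<open>Multiplying \<open>h\<close> by the denominator shifts the Fourier index by one,
    up to a phase, and gives back \<open>D - D x0\<close>. The coefficients of \<open>D\<close>
    vanish, so only the constant contributes, and only at \<open>n = 0\<close>.\<close>
  have rec: "cis (- (2 * pi * x0)) * c (n - 1) - c n = - D x0 * (if n = 0 then 1 else 0)" for n
  proof (rule has_integral_unique)
    show "((\<lambda>x. cis (- (2 * pi * x0)) * (h x * cis (- (2 * pi * of_int (n - 1) * x))) - h x * cis (- (2 * pi * of_int n * x)))
       has_integral cis (- (2 * pi * x0)) * c (n - 1) - c n) {0..1}"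
      by (intro has_integral_diff has_integral_mult_right c)
    have "((\<lambda>x. D x * cis (- (2 * pi * of_int n * x))) has_integral 0) {0..1}"
      unfolding coeff[of n, symmetric]
      by (intro integrable_integral integrable_continuous_interval continuous_intros cont)
    moreover have "((\<lambda>x. D x0 * cis (- (2 * pi * of_int n * x))) has_integral D x0 * (if n = 0 then 1 else 0)) {0..1}"
      using has_integral_mult_right[OF has_integral_cis_unit[of "- n"], of "D x0"] by simp
    ultimately have "((\<lambda>x. D x * cis (- (2 * pi * of_int n * x)) - D x0 * cis (- (2 * pi * of_int n * x)))
       has_integral 0 - D x0 * (if n = 0 then 1 else 0)) {0..1}"
      by (rule has_integral_diff)
    moreover have "cis (- (2 * pi * x0)) * (h x * cis (- (2 * pi * of_int (n - 1) * x))) - h x * cis (- (2 * pi * of_int n * x))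
       = D x * cis (- (2 * pi * of_int n * x)) - D x0 * cis (- (2 * pi * of_int n * x))" if "x \<in> {0..1}" for x
    proof -
      have "cis (- (2 * pi * x0)) * cis (- (2 * pi * of_int (n - 1) * x)) = cis (2 * pi * (x - x0)) * cis (- (2 * pi * of_int n * x))"
        by (simp add: cis_mult algebra_simps)
      then have "cis (- (2 * pi * x0)) * (h x * cis (- (2 * pi * of_int (n - 1) * x))) - h x * cis (- (2 * pi * of_int n * x))
         = h x * (cis (2 * pi * (x - x0)) - 1) * cis (- (2 * pi * of_int n * x))"
        by (simp add: algebra_simps)
      also have "h x * (cis (2 * pi * (x - x0)) - 1) = D x - D x0"
        using ne[OF that] by (auto simp: h_def)
      finally show ?thesis by (simp add: algebra_simps)
    qed
    ultimately show "((\<lambda>x. cis (- (2 * pi * x0)) * (h x * cis (- (2 * pi * of_int (n - 1) * x))) - h x * cis (- (2 * pi * of_int n * x)))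
       has_integral - D x0 * (if n = 0 then 1 else 0)) {0..1}"
      by (subst has_integral_cong) (auto simp del: of_int_diff)
  qed
  have norm_rec: "norm (c n) = norm (c (n - 1))" if "n \<noteq> 0" for n
  proof -
    have "c n = cis (- (2 * pi * x0)) * c (n - 1)" using rec[of n] that by simp
    then show ?thesis by (simp add: norm_mult)
  qed
  \<comment> \<open>A nonzero constant modulus along infinitely many indices would make the sums in
    Bessel's inequality unbounded.\<close>
  have zero: "a = 0" if "inj f" "\<And>i::nat. norm (c (f i)) = norm a" for a :: complex and f
  proof (rule ccontr)
    assume "a \<noteq> 0"
    define J where "J = integral {0..1} (\<lambda>x. (norm (h x))\<^sup>2)"
    obtain N :: nat where N: "J < of_nat N * (norm a)\<^sup>2"
      using reals_Archimedean3[of "(norm a)\<^sup>2"] \<open>a \<noteq> 0\<close> by auto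
    have "(\<Sum>n\<in>f ` {..<N}. (norm (c n))\<^sup>2) \<le> J"
      unfolding c_def J_def by (intro bessel_inequality) (auto simp: \<open>continuous_on {0..1} h\<close>)
    moreover have "(\<Sum>n\<in>f ` {..<N}. (norm (c n))\<^sup>2) = of_nat N * (norm a)\<^sup>2"
      using that by (subst sum.reindex) (auto intro: inj_on_subset)
    ultimately show False using N by simp
  qed
  have "norm (c (int i)) = norm (c 0)" for i
    by (induction i) (use norm_rec in \<open>auto simp: add.commute\<close>)
  then have "c 0 = 0" by (intro zero[of int]) (auto intro: injI)
  moreover have "norm (c (- 1 - int i)) = norm (c (- 1))" for i
  proof (induction i)
    case (Suc i)
    then show ?case using norm_rec[of "- 1 - int i"] by (simp add: algebra_simps)
  qed simp
  then have "c (- 1) = 0" by (intro zero[of "\<lambda>i. - 1 - int i"]) (auto intro: injI)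
  ultimately show ?thesis using rec[of 0] by simp
qed

section \<open>The functional equation of the theta function\<close>

text \<open>The quadratic Taylor bound for \<open>exp\<close> gives
  \<open>y^4 exp (- a y^2) \<le> 2 / a^2\<close>, and
  \<open>(1 + |y|) (1 + y^2) \<le> 4 (1 + y^4)\<close> because each of the four monomials in the
  product is at most \<open>1 + y^4\<close>. The factor \<open>1 + |y|\<close> makes one estimate
  serve a series and its derivative; the hypothesis converts decay in \<open>y\<close> into the
  summable majorant in \<open>n\<close>, whence \<open>20 = 4 * 5\<close>.\<close>

lemma gaussian_decay:
  fixes a y :: real
  assumes a: "a > 0" and y: "(real n + 1)\<^sup>2 \<le> 5 * (1 + y\<^sup>2)"
  shows "(1 + \<bar>y\<bar>) * exp (- a * y\<^sup>2) \<le> 20 * (1 + 2 / a\<^sup>2) / (real n + 1)\<^sup>2"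
proof -
  have "exp (a * y\<^sup>2) \<ge> 1 + a * y\<^sup>2 + (a * y\<^sup>2)\<^sup>2 / 2"
    using a by (intro exp_lower_Taylor_quadratic) simp
  moreover have "a * y\<^sup>2 \<ge> 0" using a by simp
  ultimately have "(a * y\<^sup>2)\<^sup>2 \<le> 2 * exp (a * y\<^sup>2)" by linarith
  then have "a\<^sup>2 * y ^ 4 * exp (- (a * y\<^sup>2)) \<le> 2"
    by (simp add: exp_minus field_simps power_mult_distrib flip: power_mult)
  then have 4: "y ^ 4 * exp (- (a * y\<^sup>2)) \<le> 2 / a\<^sup>2"
    using a by (simp add: field_simps)
  have poly: "(1 + u) * (1 + u\<^sup>2) \<le> 4 * (1 + u ^ 4)" if "u \<ge> 0" for u :: real
  proof -
    have "u ^ 3 \<le> 1 + u ^ 4" "u\<^sup>2 \<le> 1 + u ^ 4" "u \<le> 1 + u ^ 4"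
    proof -
      have "u ^ k \<le> 1 + u ^ 4" if "k \<le> 4" for k
      proof (cases "u \<le> 1")
        case True
        then have "u ^ k \<le> 1" using \<open>u \<ge> 0\<close> by (simp add: power_le_one)
        then show ?thesis using \<open>u \<ge> 0\<close> by (simp add: add_increasing2)
      next
        case False
        then have "u ^ k \<le> u ^ 4" using that by (intro power_increasing) auto
        then show ?thesis by simp
      qed
      from this[of 3] this[of 2] this[of 1] show "u ^ 3 \<le> 1 + u ^ 4" "u\<^sup>2 \<le> 1 + u ^ 4" "u \<le> 1 + u ^ 4"
        by simp_all
    qed
    moreover have "u ^ 4 \<ge> 0" using that by simp
    moreover have "1 + a + b + c \<le> 4 * (1 + d)" if "c \<le> 1 + d" "b \<le> 1 + d" "a \<le> 1 + d" "0 \<le> d" for a b c d :: real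
      using that by simp
    ultimately have "1 + u + u\<^sup>2 + u ^ 3 \<le> 4 * (1 + u ^ 4)" by blast
    moreover have "(1 + u) * (1 + u\<^sup>2) = 1 + u + u\<^sup>2 + u ^ 3"
      by (simp add: algebra_simps power2_eq_square power3_eq_cube)
    ultimately show ?thesis by (simp only:)
  qed
  have "(1 + \<bar>y\<bar>) * (1 + y\<^sup>2) * exp (- a * y\<^sup>2) \<le> 4 * (1 + y ^ 4) * exp (- a * y\<^sup>2)"
    using poly[of "\<bar>y\<bar>"] by (intro mult_right_mono) auto
  also have "\<dots> = 4 * (exp (- (a * y\<^sup>2)) + y ^ 4 * exp (- (a * y\<^sup>2)))"
    by (simp add: algebra_simps)
  also have "\<dots> \<le> 4 * (1 + 2 / a\<^sup>2)"
    using 4 a by (intro mult_left_mono add_mono) auto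
  finally have "(1 + \<bar>y\<bar>) * exp (- a * y\<^sup>2) * (1 + y\<^sup>2) \<le> 4 * (1 + 2 / a\<^sup>2)"
    by (simp add: mult_ac)
  moreover have "(1 + \<bar>y\<bar>) * exp (- a * y\<^sup>2) * (real n + 1)\<^sup>2 \<le> (1 + \<bar>y\<bar>) * exp (- a * y\<^sup>2) * (5 * (1 + y\<^sup>2))"
    using y by (intro mult_left_mono) auto
  ultimately have "(1 + \<bar>y\<bar>) * exp (- a * y\<^sup>2) * (real n + 1)\<^sup>2 \<le> 20 * (1 + 2 / a\<^sup>2)"
    by (simp add: algebra_simps)
  then show ?thesis
    by (subst pos_le_divide_eq) (auto simp: add_pos_nonneg)
qed

lemma summable_inverse_square: "summable (\<lambda>n. c / (real n + 1)\<^sup>2)"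
proof -
  have "summable (\<lambda>n. 1 / (real n + 1)\<^sup>2)"
    using inverse_squares_sums sums_summable by (simp add: add.commute)
  from summable_mult[OF this, of c] show ?thesis by simp
qed

text \<open>The integers are enumerated in pairs \<open>k = n\<close> and \<open>k = - n - 1\<close>; a prime denotes the derivative
  in \<open>x\<close>.\<close>

definition theta_term :: "real \<Rightarrow> nat \<Rightarrow> real \<Rightarrow> real" where
  "theta_term t n x = (- 1) ^ n * (exp (- (pi * t) * (x - real n)\<^sup>2) - exp (- (pi * t) * (x + real n + 1)\<^sup>2))"

definition theta_term' :: "real \<Rightarrow> nat \<Rightarrow> real \<Rightarrow> real" where
  "theta_term' t n x = - 2 * pi * t * ((- 1) ^ n *
     ((x - real n) * exp (- (pi * t) * (x - real n)\<^sup>2) - (x + real n + 1) * exp (- (pi * t) * (x + real n + 1)\<^sup>2)))"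

text \<open>The modes \<open>m = n\<close> and \<open>m = - n - 1\<close> of the sum of
  \<open>exp (- (pi / t) (m + 1/2)^2) cis ((2 m + 1) pi x)\<close>, merged into one cosine. Only odd
  multiples of \<open>pi\<close> occur as frequencies because the theta series changes sign under a
  unit shift.\<close>

definition dual_term :: "real \<Rightarrow> nat \<Rightarrow> real \<Rightarrow> real" where
  "dual_term t n x = 2 * cos ((2 * real n + 1) * pi * x) * exp (- (pi / t) * (real n + 1 / 2)\<^sup>2)"

definition dual_term' :: "real \<Rightarrow> nat \<Rightarrow> real \<Rightarrow> real" where
  "dual_term' t n x = - 2 * ((2 * real n + 1) * pi) * sin ((2 * real n + 1) * pi * x) * exp (- (pi / t) * (real n + 1 / 2)\<^sup>2)"

lemma theta_term_deriv: "(theta_term t n has_real_derivative theta_term' t n x) (at x within S)"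
  unfolding theta_term_def theta_term'_def
  by (auto intro!: derivative_eq_intros simp: algebra_simps)

lemma dual_term_deriv: "(dual_term t n has_real_derivative dual_term' t n x) (at x within S)"
  unfolding dual_term_def dual_term'_def
  by (auto intro!: derivative_eq_intros)

lemma shift_square_bounds:
  assumes "0 \<le> x" "x \<le> 1"
  shows "(real n + 1)\<^sup>2 \<le> 5 * (1 + (x - real n)\<^sup>2)" "(real n + 1)\<^sup>2 \<le> 5 * (1 + (x + real n + 1)\<^sup>2)"
proof -
  show "(real n + 1)\<^sup>2 \<le> 5 * (1 + (x - real n)\<^sup>2)"
  proof (cases "n = 0")
    case False
    then have "(real n - 1)\<^sup>2 \<le> (real n - x)\<^sup>2"
      using assms by (intro power_mono) auto
    \<comment> \<open>The constant 5 is the one for which this difference is a perfect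
      square.\<close>
    moreover have "5 * (1 + (real n - 1)\<^sup>2) - (real n + 1)\<^sup>2 = (2 * real n - 3)\<^sup>2"
      by (simp add: power2_eq_square algebra_simps)
    then have "(real n + 1)\<^sup>2 \<le> 5 * (1 + (real n - 1)\<^sup>2)"
      by (metis diff_ge_0_iff_ge zero_le_power2)
    ultimately show ?thesis by (simp add: power2_commute)
  qed simp
  have "(real n + 1)\<^sup>2 \<le> (x + real n + 1)\<^sup>2"
    using assms by (intro power_mono) auto
  then show "(real n + 1)\<^sup>2 \<le> 5 * (1 + (x + real n + 1)\<^sup>2)"
    by (rule order_trans) simp
qed

text \<open>The Gaussian pieces are bounded one by one because \<open>cardy_numerator\<close> needs
  them before they are paired.\<close>

lemma theta_term_bounds:
  fixes n :: nat
  assumes t: "t > 0" and x: "0 \<le> x" "x \<le> 1"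
  defines "M \<equiv> 20 * (1 + 2 / (pi * t)\<^sup>2) / (real n + 1)\<^sup>2"
  shows "exp (- (pi * t) * (x - real n)\<^sup>2) \<le> M" "exp (- (pi * t) * (x + real n + 1)\<^sup>2) \<le> M"
    "\<bar>x - real n\<bar> * exp (- (pi * t) * (x - real n)\<^sup>2) \<le> M"
    "\<bar>x + real n + 1\<bar> * exp (- (pi * t) * (x + real n + 1)\<^sup>2) \<le> M"
proof -
  have 1: "(1 + \<bar>x - real n\<bar>) * exp (- (pi * t) * (x - real n)\<^sup>2) \<le> M"
    unfolding M_def using t by (intro gaussian_decay shift_square_bounds x) simp
  have 2: "(1 + \<bar>x + real n + 1\<bar>) * exp (- (pi * t) * (x + real n + 1)\<^sup>2) \<le> M"
    unfolding M_def using t by (intro gaussian_decay shift_square_bounds x) simp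
  have *: "e \<le> M \<and> u * e \<le> M" if "(1 + u) * e \<le> M" "u \<ge> 0" "e \<ge> 0" for u e :: real
  proof -
    have "u * e \<ge> 0" using that by simp
    then show ?thesis using that(1,3) by (simp add: ring_distribs)
  qed
  show "exp (- (pi * t) * (x - real n)\<^sup>2) \<le> M" "exp (- (pi * t) * (x + real n + 1)\<^sup>2) \<le> M"
    "\<bar>x - real n\<bar> * exp (- (pi * t) * (x - real n)\<^sup>2) \<le> M"
    "\<bar>x + real n + 1\<bar> * exp (- (pi * t) * (x + real n + 1)\<^sup>2) \<le> M"
    using *[OF 1] *[OF 2] by simp_all
qed

lemma theta_term_le:
  assumes t: "t > 0" and x: "0 \<le> x" "x \<le> 1"
  shows "\<bar>theta_term t n x\<bar> \<le> 40 * (1 + 2 / (pi * t)\<^sup>2) / (real n + 1)\<^sup>2"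
    and "\<bar>theta_term' t n x\<bar> \<le> 2 * pi * t * (40 * (1 + 2 / (pi * t)\<^sup>2)) / (real n + 1)\<^sup>2"
proof -
  note b = theta_term_bounds[OF assms, of n]
  have *: "2 * pi * t * (20 * A / N + 20 * A / N) = 2 * pi * t * (40 * A) / N" for A N :: real
    by (simp add: divide_inverse)
  have "\<bar>theta_term t n x\<bar> \<le> exp (- (pi * t) * (x - real n)\<^sup>2) + exp (- (pi * t) * (x + real n + 1)\<^sup>2)"
    unfolding theta_term_def abs_mult power_abs abs_minus_cancel abs_one power_one mult_1
    by (rule order_trans[OF abs_triangle_ineq4]) simp
  also have "\<dots> \<le> 20 * (1 + 2 / (pi * t)\<^sup>2) / (real n + 1)\<^sup>2 + 20 * (1 + 2 / (pi * t)\<^sup>2) / (real n + 1)\<^sup>2"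
    by (intro add_mono b)
  finally show "\<bar>theta_term t n x\<bar> \<le> 40 * (1 + 2 / (pi * t)\<^sup>2) / (real n + 1)\<^sup>2"
    by (simp add: add_divide_distrib)
  have "\<bar>theta_term' t n x\<bar> \<le> 2 * pi * t * (\<bar>x - real n\<bar> * exp (- (pi * t) * (x - real n)\<^sup>2) + \<bar>x + real n + 1\<bar> * exp (- (pi * t) * (x + real n + 1)\<^sup>2))"
    unfolding theta_term'_def abs_mult power_abs abs_minus_cancel abs_one power_one mult_1
    by (intro mult_mono order_trans[OF abs_triangle_ineq4]) (use t in \<open>auto simp: abs_mult\<close>)
  also have "\<dots> \<le> 2 * pi * t * (20 * (1 + 2 / (pi * t)\<^sup>2) / (real n + 1)\<^sup>2 + 20 * (1 + 2 / (pi * t)\<^sup>2) / (real n + 1)\<^sup>2)"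
    using t by (intro mult_left_mono add_mono b) simp
  finally show "\<bar>theta_term' t n x\<bar> \<le> 2 * pi * t * (40 * (1 + 2 / (pi * t)\<^sup>2)) / (real n + 1)\<^sup>2"
    using *[of "1 + 2 / (pi * t)\<^sup>2" "(real n + 1)\<^sup>2"] by (simp only:)
qed

lemma dual_term_le:
  assumes t: "t > 0"
  shows "\<bar>dual_term t n x\<bar> \<le> 40 * (1 + 2 / (pi / t)\<^sup>2) / (real n + 1)\<^sup>2"
    and "\<bar>dual_term' t n x\<bar> \<le> 80 * pi * (1 + 2 / (pi / t)\<^sup>2) / (real n + 1)\<^sup>2"
proof -
  define E where "E = exp (- (pi / t) * (real n + 1 / 2)\<^sup>2)"
  have E: "E \<ge> 0" by (simp add: E_def)
  have 1: "(1 + \<bar>real n + 1 / 2\<bar>) * E \<le> 20 * (1 + 2 / (pi / t)\<^sup>2) / (real n + 1)\<^sup>2"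
    unfolding E_def
  proof (rule gaussian_decay)
    show "(real n + 1)\<^sup>2 \<le> 5 * (1 + (real n + 1 / 2)\<^sup>2)"
    proof -
      have "5 * (1 + (real n + 1 / 2)\<^sup>2) - (real n + 1)\<^sup>2 = 4 * (real n)\<^sup>2 + 3 * real n + 21 / 4"
        by (simp add: power2_eq_square algebra_simps)
      also have "\<dots> \<ge> 0" by simp
      finally show ?thesis by linarith
    qed
  qed (use t in simp)
  have "real n * E \<ge> 0" using E by simp
  moreover have "(1 + \<bar>real n + 1 / 2\<bar>) * E = 3 / 2 * E + real n * E" "(2 * real n + 1) * E = 2 * (real n * E) + E"
    by (simp_all add: ring_distribs)
  moreover have *: "e \<le> K \<and> 2 * ne + e \<le> 2 * K" if "3 / 2 * e + ne \<le> K" "0 \<le> e" "0 \<le> ne" for e ne K :: real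
    using that by simp
  ultimately have 2: "E \<le> 20 * (1 + 2 / (pi / t)\<^sup>2) / (real n + 1)\<^sup>2"
    and 3: "(2 * real n + 1) * E \<le> 2 * (20 * (1 + 2 / (pi / t)\<^sup>2) / (real n + 1)\<^sup>2)"
    using 1 E * by metis+
  have "\<bar>dual_term t n x\<bar> = 2 * (\<bar>cos ((2 * real n + 1) * pi * x)\<bar> * E)"
    by (simp add: dual_term_def E_def abs_mult)
  also have "\<dots> \<le> 2 * (1 * E)"
    using E by (intro mult_left_mono mult_right_mono abs_cos_le_one) auto
  also have "\<dots> \<le> 2 * (20 * (1 + 2 / (pi / t)\<^sup>2) / (real n + 1)\<^sup>2)"
    using 2 by (simp only: mult_1 mult_le_cancel_left_pos zero_less_numeral)
  finally show "\<bar>dual_term t n x\<bar> \<le> 40 * (1 + 2 / (pi / t)\<^sup>2) / (real n + 1)\<^sup>2"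
    by simp
  have "\<bar>dual_term' t n x\<bar> = \<bar>sin ((2 * real n + 1) * pi * x)\<bar> * (2 * pi * ((2 * real n + 1) * E))"
    by (simp add: dual_term'_def E_def abs_mult)
  also have "\<dots> \<le> 1 * (2 * pi * (2 * (20 * (1 + 2 / (pi / t)\<^sup>2) / (real n + 1)\<^sup>2)))"
    using E by (intro mult_mono[OF abs_sin_le_one mult_left_mono[OF 3]]) auto
  also have "\<dots> = 80 * pi * (1 + 2 / (pi / t)\<^sup>2) / (real n + 1)\<^sup>2"
    by (simp only: mult_1 times_divide_eq_right)
  finally show "\<bar>dual_term' t n x\<bar> \<le> 80 * pi * (1 + 2 / (pi / t)\<^sup>2) / (real n + 1)\<^sup>2" .
qed

section \<open>Termwise differentiation and integration\<close>

lemma suminf_has_derivative_Mtest: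
  fixes f f' :: "nat \<Rightarrow> real \<Rightarrow> real"
  assumes "\<And>n x. x \<in> {0..1} \<Longrightarrow> (f n has_real_derivative f' n x) (at x within {0..1})"
    and "\<And>n x. x \<in> {0..1} \<Longrightarrow> \<bar>f n x\<bar> \<le> M / (real n + 1)\<^sup>2"
    and "\<And>n x. x \<in> {0..1} \<Longrightarrow> \<bar>f' n x\<bar> \<le> M' / (real n + 1)\<^sup>2"
    and x: "0 < x" "x < 1"
  shows "((\<lambda>x. \<Sum>n. f n x) has_real_derivative (\<Sum>n. f' n x)) (at x)"
proof (rule has_field_derivative_series'(2))
  show "uniformly_convergent_on {0..1} (\<lambda>n x. \<Sum>i<n. f' i x)"
    by (rule Weierstrass_m_test'[OF _ summable_inverse_square[of M']]) (use assms(3) in simp)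
  show "summable (\<lambda>n. f n 0)"
    by (rule summable_comparison_test'[OF summable_inverse_square[of M], where N = 0]) (use assms(2) in simp)
qed (use assms in auto)

lemma theta_has_derivative:
  assumes "t > 0" "0 < x" "x < 1"
  shows "((\<lambda>x. \<Sum>n. theta_term t n x) has_real_derivative (\<Sum>n. theta_term' t n x)) (at x)"
  using assms theta_term_deriv theta_term_le
  by (intro suminf_has_derivative_Mtest) auto

lemma dual_has_derivative:
  assumes "t > 0" "0 < x" "x < 1"
  shows "((\<lambda>x. \<Sum>n. dual_term t n x) has_real_derivative (\<Sum>n. dual_term' t n x)) (at x)"
  using assms dual_term_deriv dual_term_le
  by (intro suminf_has_derivative_Mtest) auto

lemma continuous_on_suminf_Mtest:
  fixes f :: "nat \<Rightarrow> real \<Rightarrow> 'a::banach"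
  assumes "\<And>n. continuous_on {0..1} (f n)"
    and "\<And>n x. x \<in> {0..1} \<Longrightarrow> norm (f n x) \<le> M / (real n + 1)\<^sup>2"
  shows "continuous_on {0..1} (\<lambda>x. \<Sum>n. f n x)"
proof (rule uniform_limit_theorem)
  show "uniform_limit {0..1} (\<lambda>n x. \<Sum>i<n. f i x) (\<lambda>x. \<Sum>n. f n x) sequentially"
    by (rule Weierstrass_m_test[OF _ summable_inverse_square[of M]]) (use assms(2) in simp)
qed (auto intro!: always_eventually continuous_intros assms)

lemma integral_suminf_Mtest:
  fixes f :: "nat \<Rightarrow> real \<Rightarrow> complex"
  assumes "\<And>n. continuous_on {0..1} (f n)"
    and "\<And>n x. x \<in> {0..1} \<Longrightarrow> norm (f n x) \<le> M / (real n + 1)\<^sup>2"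
  shows "(\<lambda>n. integral {0..1} (f n)) sums integral {0..1} (\<lambda>x. \<Sum>n. f n x)"
proof -
  have u: "uniform_limit {0..1} (\<lambda>n x. \<Sum>i<n. f i x) (\<lambda>x. \<Sum>n. f n x) sequentially"
    by (rule Weierstrass_m_test[OF _ summable_inverse_square[of M]]) (use assms(2) in simp)
  have c: "continuous_on {0..1} (\<lambda>x. \<Sum>i<n. f i x)" for n
    by (intro continuous_intros assms)
  obtain I J where I: "\<And>n. ((\<lambda>x. \<Sum>i<n. f i x) has_integral I n) {0..1}"
    and J: "((\<lambda>x. \<Sum>n. f n x) has_integral J) {0..1}" and lim: "I \<longlonglongrightarrow> J"
    by (rule uniform_limit_integral[OF u c]) auto
  have "I n = (\<Sum>i<n. integral {0..1} (f i))" for n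
  proof (rule has_integral_unique[OF I])
    show "((\<lambda>x. \<Sum>i<n. f i x) has_integral (\<Sum>i<n. integral {0..1} (f i))) {0..1}"
      by (intro has_integral_sum integrable_integral integrable_continuous_interval assms) simp
  qed
  then have "I = (\<lambda>n. \<Sum>i<n. integral {0..1} (f i))" by (rule ext)
  then show "(\<lambda>n. integral {0..1} (f n)) sums integral {0..1} (\<lambda>x. \<Sum>n. f n x)"
    using lim integral_unique[OF J] by (simp add: sums_def)
qed

section \<open>Fourier coefficients of the two series\<close>

lemma gaussian_fourier_transform:
  fixes t s :: real
  assumes t: "t > 0"
  defines "\<phi> \<equiv> \<lambda>y. complex_of_real (exp (- (pi * t) * y\<^sup>2)) * cis (s * y)"
  shows "integrable lborel \<phi>"
    and "integral\<^sup>L lborel \<phi> = of_real (exp (- s\<^sup>2 / (4 * pi * t)) / sqrt t)"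
proof -
  \<comment> \<open>With \<open>a^2 = 2 pi t\<close>, the substitution \<open>x = a y\<close> turns
    the Gaussian into a multiple of the standard normal density, whose characteristic function at
    \<open>s / a\<close> is the desired integral up to scaling.\<close>
  define a where "a = sqrt (2 * pi * t)"
  have a: "a > 0" "a\<^sup>2 = 2 * pi * t" using t by (simp_all add: a_def)
  define \<psi> where "\<psi> = (\<lambda>x. std_normal_density x *\<^sub>R iexp (s / a * x))"
  have \<phi>: "\<phi> y = of_real (sqrt (2 * pi)) * \<psi> (0 + a * y)" for y
    using a by (simp add: \<phi>_def \<psi>_def std_normal_density_def scaleR_conv_of_real power_mult_distrib cis_conv_exp field_simps)
  have int_\<psi>: "integrable lborel \<psi>"
  proof (rule Bochner_Integration.integrable_bound[OF integrable_normal_density[of 1 0]])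
    show "\<psi> \<in> borel_measurable lborel" unfolding \<psi>_def by simp
    show "AE x in lborel. norm (\<psi> x) \<le> norm (normal_density 0 1 x)"
      by (simp add: \<psi>_def norm_mult)
  qed simp
  then have "integrable lborel (\<lambda>y. \<psi> (0 + a * y))"
    using a by (intro lborel_integrable_real_affine) auto
  then show "integrable lborel \<phi>"
    unfolding \<phi>[abs_def] by (rule integrable_mult_right)
  have "integral\<^sup>L lborel \<psi> = char std_normal_distribution (s / a)"
    unfolding char_def \<psi>_def by (subst integral_density) auto
  also have "\<dots> = of_real (exp (- (s / a)\<^sup>2 / 2))"
    by (simp add: char_std_normal_distribution)
  also have "(s / a)\<^sup>2 / 2 = s\<^sup>2 / (4 * pi * t)"
    unfolding power_divide a(2) by simp
  then have "- (s / a)\<^sup>2 / 2 = - s\<^sup>2 / (4 * pi * t)" by simp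
  finally have 1: "integral\<^sup>L lborel \<psi> = of_real (exp (- s\<^sup>2 / (4 * pi * t)))" .
  have "integral\<^sup>L lborel \<psi> = \<bar>a\<bar> *\<^sub>R integral\<^sup>L lborel (\<lambda>y. \<psi> (0 + a * y))"
    using a by (intro lborel_integral_real_affine) simp
  then have 2: "integral\<^sup>L lborel (\<lambda>y. \<psi> (0 + a * y)) = integral\<^sup>L lborel \<psi> / of_real a"
    using a by (simp add: scaleR_conv_of_real)
  have "integral\<^sup>L lborel \<phi> = of_real (sqrt (2 * pi)) * (integral\<^sup>L lborel \<psi> / of_real a)"
    unfolding \<phi>[abs_def] integral_mult_right_zero 2 ..
  then show "integral\<^sup>L lborel \<phi> = of_real (exp (- s\<^sup>2 / (4 * pi * t)) / sqrt t)"
    unfolding 1 using t by (simp add: a_def real_sqrt_mult)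
qed

lemma integral_exhausting_intervals:
  fixes \<phi> :: "real \<Rightarrow> complex"
  assumes int: "integrable lborel \<phi>" and cont: "continuous_on UNIV \<phi>"
  shows "(\<lambda>N. integral {1 - real N..1 + real N} \<phi>) \<longlonglongrightarrow> integral\<^sup>L lborel \<phi>"
proof -
  have "(\<lambda>N. LINT x|lborel. indicat_real {1 - real N..1 + real N} x *\<^sub>R \<phi> x) \<longlonglongrightarrow> integral\<^sup>L lborel \<phi>"
  proof (rule integral_dominated_convergence[where w = "\<lambda>x. norm (\<phi> x)"])
    show "AE x in lborel. (\<lambda>N. indicat_real {1 - real N..1 + real N} x *\<^sub>R \<phi> x) \<longlonglongrightarrow> \<phi> x"
    proof (intro AE_I2 tendsto_eventually)
      fix x :: real
      obtain K :: nat where K: "\<bar>x - 1\<bar> \<le> real K" using real_arch_simple by blast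
      show "\<forall>\<^sub>F N in sequentially. indicat_real {1 - real N..1 + real N} x *\<^sub>R \<phi> x = \<phi> x"
        using eventually_ge_at_top[of K]
      proof eventually_elim
        case (elim N)
        then have "\<bar>x - 1\<bar> \<le> real N" using K by linarith
        then have "x \<in> {1 - real N..1 + real N}" by (auto simp: abs_le_iff)
        then show ?case by simp
      qed
    qed
    show "AE x in lborel. norm (indicat_real {1 - real N..1 + real N} x *\<^sub>R \<phi> x) \<le> norm (\<phi> x)" for N
      by (intro AE_I2) (simp add: indicator_def)
  qed (use int in \<open>auto intro!: borel_measurable_integrable integrable_norm\<close>)
  moreover have "(LINT x|lborel. indicat_real {1 - real N..1 + real N} x *\<^sub>R \<phi> x) = integral {1 - real N..1 + real N} \<phi>" for N
  proof -
    have "set_integrable lborel {1 - real N..1 + real N} \<phi>"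
      by (intro borel_integrable_atLeastAtMost' continuous_on_subset[OF cont]) simp
    from set_borel_integral_eq_integral(2)[OF this] show ?thesis
      unfolding set_lebesgue_integral_def .
  qed
  ultimately show ?thesis by simp
qed

text \<open>Unfolding: the translates of the unit interval by \<open>- n\<close> and by
  \<open>n + 1\<close>, for \<open>n < N\<close>, tile \<open>{1 - real N..1 + real N}\<close>. This
  is why the exhausting intervals are centred at 1.\<close>

lemma sum_unit_integrals:
  fixes \<phi> :: "real \<Rightarrow> complex"
  assumes cont: "continuous_on UNIV \<phi>"
  shows "(\<Sum>n<N. integral {0..1} (\<lambda>x. \<phi> (x - real n) + \<phi> (x + real n + 1))) = integral {1 - real N..1 + real N} \<phi>"
proof (induction N)
  case (Suc N)
  have int: "\<phi> integrable_on {a..b}" for a b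
    by (intro integrable_continuous_interval continuous_on_subset[OF cont]) simp
  have cs: "continuous_on {0..1} (\<lambda>x. \<phi> (f x))" if "continuous_on {0..1} f" for f :: "real \<Rightarrow> real"
    using that by (intro continuous_on_compose2[OF cont]) auto
  have "integral {0..1} (\<lambda>x. \<phi> (x - real N) + \<phi> (x + real N + 1)) =
     integral {0..1} (\<lambda>x. \<phi> (x - real N)) + integral {0..1} (\<lambda>x. \<phi> (x + real N + 1))"
    by (intro Henstock_Kurzweil_Integration.integral_add integrable_continuous_interval cs continuous_intros)
  also have "integral {0..1} (\<lambda>x. \<phi> (x - real N)) = integral {- real N..1 - real N} \<phi>"
    using integral_shift_real_ivl[of "- real N" "- real N" "1 - real N" \<phi>] by simp
  also have "integral {0..1} (\<lambda>x. \<phi> (x + real N + 1)) = integral {real N + 1..real N + 2} \<phi>"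
    using integral_shift_real_ivl[of "real N + 1" "real N + 1" "real N + 2" \<phi>] by (simp add: add.assoc)
  finally have "(\<Sum>n<Suc N. integral {0..1} (\<lambda>x. \<phi> (x - real n) + \<phi> (x + real n + 1))) =
     integral {- real N..1 - real N} \<phi> + integral {1 - real N..1 + real N} \<phi> + integral {1 + real N..real N + 2} \<phi>"
    using Suc.IH by (simp add: add_ac)
  also have "integral {- real N..1 - real N} \<phi> + integral {1 - real N..1 + real N} \<phi> = integral {- real N..1 + real N} \<phi>"
    by (intro Henstock_Kurzweil_Integration.integral_combine int) auto
  also have "\<dots> + integral {1 + real N..real N + 2} \<phi> = integral {- real N..real N + 2} \<phi>"
    by (intro Henstock_Kurzweil_Integration.integral_combine int) auto
  finally show ?case by (simp add: add.commute)
qed simp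

text \<open>At an odd multiple of \<open>pi\<close> a unit shift costs a factor
  \<open>cis pi = - 1\<close>. This absorbs the alternating sign of the theta series, so that both
  halves of a term become translates of one function.\<close>

lemma cis_odd_shift:
  "cis (- ((2 * real_of_int m + 1) * pi) * (x - real n)) = (- 1) ^ n * cis (- ((2 * real_of_int m + 1) * pi) * x)"
proof (induction n arbitrary: x)
  case (Suc n)
  have "- ((2 * real_of_int m + 1) * pi) * (x - real (Suc n)) =
     - ((2 * real_of_int m + 1) * pi) * (x - real n) + (2 * pi * of_int m + pi)"
    by (simp add: algebra_simps)
  then have "cis (- ((2 * real_of_int m + 1) * pi) * (x - real (Suc n))) =
     cis (- ((2 * real_of_int m + 1) * pi) * (x - real n)) * (cis (2 * pi * of_int m) * cis pi)"
    by (simp only: cis_mult)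
  also have "cis (2 * pi * of_int m) = 1"
    by (rule cis_multiple_2pi) simp
  finally show ?case using Suc by simp
qed simp

lemma theta_fourier_coefficient:
  assumes t: "t > 0"
  shows "integral {0..1} (\<lambda>x. of_real (\<Sum>n. theta_term t n x) * cis (- ((2 * real_of_int m + 1) * pi) * x)) =
     of_real (exp (- (pi / t) * (of_int m + 1 / 2)\<^sup>2) / sqrt t)"
proof -
  define s where "s = - ((2 * real_of_int m + 1) * pi)"
  define \<phi> where "\<phi> = (\<lambda>y. complex_of_real (exp (- (pi * t) * y\<^sup>2)) * cis (s * y))"
  define f where "f = (\<lambda>n x. of_real (theta_term t n x) * cis (s * x))"
  have f: "f n x = \<phi> (x - real n) + \<phi> (x + real n + 1)" for n x
  proof -
    have 1: "cis (s * (x - real n)) = (- 1) ^ n * cis (s * x)"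
      unfolding s_def by (rule cis_odd_shift)
    have "cis (s * (x + real n + 1 - real (Suc n))) = (- 1) ^ Suc n * cis (s * (x + real n + 1))"
      unfolding s_def by (rule cis_odd_shift)
    then have "(- 1) ^ n * cis (s * x) = (- 1) ^ n * ((- 1) ^ Suc n * cis (s * (x + real n + 1)))"
      by simp
    then have 2: "cis (s * (x + real n + 1)) = - ((- 1) ^ n * cis (s * x))"
      by (simp flip: power_add mult.assoc)
    show ?thesis
      unfolding f_def \<phi>_def 1 2 theta_term_def by (simp add: algebra_simps)
  qed
  have cont_\<phi>: "continuous_on UNIV \<phi>"
    unfolding \<phi>_def by (intro continuous_intros)
  have "(\<lambda>n. integral {0..1} (f n)) sums integral {0..1} (\<lambda>x. \<Sum>n. f n x)"
  proof (rule integral_suminf_Mtest)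
    show "continuous_on {0..1} (f n)" for n
      unfolding f_def theta_term_def by (intro continuous_intros)
    show "norm (f n x) \<le> 40 * (1 + 2 / (pi * t)\<^sup>2) / (real n + 1)\<^sup>2" if "x \<in> {0..1}" for n x
      using theta_term_le(1)[of t x n] that t by (simp add: f_def norm_mult)
  qed
  \<comment> \<open>The same partial sums are evaluated a second way, as integrals over growing
    intervals; comparing the two limits gives the coefficient as an integral over the whole
    line.\<close>
  moreover have "(\<lambda>N. \<Sum>n<N. integral {0..1} (f n)) \<longlonglongrightarrow> integral\<^sup>L lborel \<phi>"
    unfolding f[abs_def] sum_unit_integrals[OF cont_\<phi>]
    by (intro integral_exhausting_intervals cont_\<phi>) (unfold \<phi>_def, rule gaussian_fourier_transform(1)[OF t])
  ultimately have "integral {0..1} (\<lambda>x. \<Sum>n. f n x) = integral\<^sup>L lborel \<phi>"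
    unfolding sums_def by (rule LIMSEQ_unique)
  also have "\<dots> = of_real (exp (- s\<^sup>2 / (4 * pi * t)) / sqrt t)"
    unfolding \<phi>_def by (rule gaussian_fourier_transform(2)[OF t])
  also have "- s\<^sup>2 / (4 * pi * t) = - (pi / t) * (of_int m + 1 / 2)\<^sup>2"
    using t by (simp add: s_def field_simps power2_eq_square)
  also have "integral {0..1} (\<lambda>x. \<Sum>n. f n x) = integral {0..1} (\<lambda>x. of_real (\<Sum>n. theta_term t n x) * cis (s * x))"
  proof (rule Henstock_Kurzweil_Integration.integral_cong)
    fix x :: real assume x: "x \<in> {0..1}"
    have "summable (\<lambda>n. theta_term t n x)"
      by (rule summable_comparison_test'[OF summable_inverse_square, where N = 0])
         (use theta_term_le(1)[OF t, of x] x in simp)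
    then have "(\<lambda>n. of_real (theta_term t n x) * cis (s * x)) sums (of_real (\<Sum>n. theta_term t n x) * cis (s * x))"
      by (intro sums_mult2 sums_of_real summable_sums)
    then show "(\<Sum>n. f n x) = of_real (\<Sum>n. theta_term t n x) * cis (s * x)"
      unfolding f_def by (rule sums_unique[symmetric])
  qed
  finally show ?thesis by (simp add: s_def)
qed

lemma dual_fourier_coefficient:
  assumes t: "t > 0"
  shows "integral {0..1} (\<lambda>x. of_real (\<Sum>n. dual_term t n x) * cis (- ((2 * real_of_int m + 1) * pi) * x)) =
     of_real (exp (- (pi / t) * (of_int m + 1 / 2)\<^sup>2))"
proof -
  define s where "s = - ((2 * real_of_int m + 1) * pi)"
  define f where "f = (\<lambda>n x. of_real (dual_term t n x) * cis (s * x))"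
  define E where "E = (\<lambda>n. exp (- (pi / t) * (real n + 1 / 2)\<^sup>2))"
  \<comment> \<open>The one pair \<open>{k, - k - 1}\<close> that contains \<open>m\<close>; the
    square of \<open>k + 1/2\<close> is the same for both members.\<close>
  define k where "k = (if m \<ge> 0 then nat m else nat (- m - 1))"
  have "integral {0..1} (f n) = (if n = k then of_real (E k) else 0)" for n
  proof (rule integral_unique)
    have "2 * complex_of_real (cos u) * cis v = cis (u + v) + cis (v - u)" for u v
    proof -
      have "2 * complex_of_real (cos u) = cis u + cis (- u)"
        by (simp add: complex_eq_iff)
      then show ?thesis by (simp add: cis_mult ring_distribs)
    qed
    note cos_cis = this
    have f: "f n x = of_real (E n) * (cis (2 * pi * of_int (int n - m) * x) + cis (2 * pi * of_int (- int n - 1 - m) * x))" for x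
    proof -
      have "f n x = of_real (E n) * (2 * of_real (cos ((2 * real n + 1) * pi * x)) * cis (s * x))"
        by (simp add: f_def dual_term_def E_def mult_ac)
      moreover have "(2 * real n + 1) * pi * x + s * x = 2 * pi * of_int (int n - m) * x"
        "s * x - (2 * real n + 1) * pi * x = 2 * pi * of_int (- int n - 1 - m) * x"
        by (simp_all add: s_def algebra_simps)
      ultimately show ?thesis by (simp only: cos_cis)
    qed
    moreover have "((\<lambda>x. of_real (E n) * (cis (2 * pi * of_int (int n - m) * x) + cis (2 * pi * of_int (- int n - 1 - m) * x)))
       has_integral of_real (E n) * ((if int n - m = 0 then 1 else 0) + (if - int n - 1 - m = 0 then 1 else 0))) {0..1}"
      by (intro has_integral_mult_right has_integral_add has_integral_cis_unit)
    moreover have "of_real (E n) * ((if int n - m = 0 then 1 else 0) + (if - int n - 1 - m = 0 then 1 else 0)) =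
       (if n = k then complex_of_real (E k) else 0)"
      by (auto simp: k_def)
    ultimately show "(f n has_integral (if n = k then of_real (E k) else 0)) {0..1}"
      by (simp only: f[abs_def])
  qed
  then have "(\<lambda>n. integral {0..1} (f n)) sums of_real (E k)"
    using sums_single[of k "\<lambda>_. complex_of_real (E k)"] by (simp cong: if_cong)
  moreover have "(\<lambda>n. integral {0..1} (f n)) sums integral {0..1} (\<lambda>x. \<Sum>n. f n x)"
  proof (rule integral_suminf_Mtest)
    show "continuous_on {0..1} (f n)" for n
      unfolding f_def dual_term_def by (intro continuous_intros)
    show "norm (f n x) \<le> 40 * (1 + 2 / (pi / t)\<^sup>2) / (real n + 1)\<^sup>2" for n x
      using dual_term_le(1)[of t n x] t by (simp add: f_def norm_mult)
  qed
  ultimately have "integral {0..1} (\<lambda>x. \<Sum>n. f n x) = of_real (E k)"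
    by (rule sums_unique2[symmetric])
  also have "E k = exp (- (pi / t) * (of_int m + 1 / 2)\<^sup>2)"
  proof -
    have "(real k + 1 / 2)\<^sup>2 = (of_int m + 1 / 2)\<^sup>2"
      by (auto simp: k_def power2_eq_square algebra_simps)
    then show ?thesis by (simp only: E_def)
  qed
  also have "integral {0..1} (\<lambda>x. \<Sum>n. f n x) = integral {0..1} (\<lambda>x. of_real (\<Sum>n. dual_term t n x) * cis (s * x))"
  proof (rule Henstock_Kurzweil_Integration.integral_cong)
    fix x :: real
    have "summable (\<lambda>n. dual_term t n x)"
      by (rule summable_comparison_test'[OF summable_inverse_square, where N = 0])
         (use dual_term_le(1)[OF t, of _ x] in simp)
    then have "(\<lambda>n. of_real (dual_term t n x) * cis (s * x)) sums (of_real (\<Sum>n. dual_term t n x) * cis (s * x))"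
      by (intro sums_mult2 sums_of_real summable_sums)
    then show "(\<Sum>n. f n x) = of_real (\<Sum>n. dual_term t n x) * cis (s * x)"
      unfolding f_def by (rule sums_unique[symmetric])
  qed
  finally show ?thesis by (simp add: s_def)
qed


theorem theta_functional_equation:
  assumes t: "t > 0" and x: "0 < x" "x < 1"
  shows "sqrt t * (\<Sum>n. theta_term t n x) = (\<Sum>n. dual_term t n x)"
proof -
  define \<Theta> where "\<Theta> = (\<lambda>x. \<Sum>n. theta_term t n x)"
  define G where "G = (\<lambda>x. \<Sum>n. dual_term t n x)"
  \<comment> \<open>The twist by \<open>cis (- pi * x)\<close> moves the odd multiples of
    \<open>pi\<close> to multiples of \<open>2 pi\<close>, where
    \<open>fourier_coefficients_zero\<close> applies. All coefficients of \<open>D\<close> vanish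
    since the two series, weighted by \<open>sqrt t\<close> and 1, have equal ones.\<close>
  define D where "D = (\<lambda>x. complex_of_real (sqrt t * \<Theta> x - G x) * cis (- pi * x))"
  have cont_\<Theta>: "continuous_on {0..1} \<Theta>"
    unfolding \<Theta>_def
  proof (rule continuous_on_suminf_Mtest)
    show "continuous_on {0..1} (theta_term t n)" for n
      unfolding theta_term_def by (intro continuous_intros)
    show "norm (theta_term t n x) \<le> 40 * (1 + 2 / (pi * t)\<^sup>2) / (real n + 1)\<^sup>2" if "x \<in> {0..1}" for n x
      using theta_term_le(1)[of t x n] that t by simp
  qed
  have cont_G: "continuous_on {0..1} G"
    unfolding G_def
  proof (rule continuous_on_suminf_Mtest)
    show "continuous_on {0..1} (dual_term t n)" for n
      unfolding dual_term_def by (intro continuous_intros)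
    show "norm (dual_term t n x) \<le> 40 * (1 + 2 / (pi / t)\<^sup>2) / (real n + 1)\<^sup>2" for n x
      using dual_term_le(1)[of t n x] t by simp
  qed
  have "D x = 0"
  proof (rule fourier_coefficients_zero[OF _ x])
    show "continuous_on {0..1} D"
      unfolding D_def by (intro continuous_intros cont_\<Theta> cont_G)
    have "((\<lambda>x. sqrt t * \<Theta> x - G x) has_real_derivative sqrt t * (\<Sum>n. theta_term' t n x) - (\<Sum>n. dual_term' t n x)) (at x)"
      unfolding \<Theta>_def G_def
      by (intro DERIV_diff DERIV_cmult theta_has_derivative dual_has_derivative t x)
    then have 1: "((\<lambda>x. complex_of_real (sqrt t * \<Theta> x - G x)) has_vector_derivative
        of_real (sqrt t * (\<Sum>n. theta_term' t n x) - (\<Sum>n. dual_term' t n x))) (at x)"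
      by (intro has_vector_derivative_of_real) (simp add: has_real_derivative_iff_has_vector_derivative)
    have "((\<lambda>z. exp (\<i> * of_real (- pi) * z)) has_field_derivative \<i> * of_real (- pi) * exp (\<i> * of_real (- pi) * of_real x)) (at (of_real x))"
      by (auto intro!: derivative_eq_intros)
    from has_vector_derivative_real_field[OF this]
    have 2: "((\<lambda>x. cis (- pi * x)) has_vector_derivative \<i> * of_real (- pi) * cis (- pi * x)) (at x)"
      by (simp add: cis_conv_exp mult.assoc)
    show "(D has_vector_derivative of_real (sqrt t * \<Theta> x - G x) * (\<i> * of_real (- pi) * cis (- pi * x)) +
        of_real (sqrt t * (\<Sum>n. theta_term' t n x) - (\<Sum>n. dual_term' t n x)) * cis (- pi * x)) (at x)"
      unfolding D_def by (rule has_vector_derivative_mult[OF 1 2])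
    show "integral {0..1} (\<lambda>x. D x * cis (- (2 * pi * real_of_int m * x))) = 0" for m :: int
    proof -
      let ?c = "\<lambda>x. cis (- ((2 * real_of_int m + 1) * pi) * x)"
      have "D x * cis (- (2 * pi * real_of_int m * x)) =
          of_real (sqrt t) * (of_real (\<Theta> x) * ?c x) - of_real (G x) * ?c x" for x
      proof -
        have "cis (- pi * x) * cis (- (2 * pi * real_of_int m * x)) = ?c x"
          by (simp add: cis_mult algebra_simps)
        then show ?thesis by (simp add: D_def algebra_simps)
      qed
      then have "integral {0..1} (\<lambda>x. D x * cis (- (2 * pi * real_of_int m * x))) =
          integral {0..1} (\<lambda>x. of_real (sqrt t) * (of_real (\<Theta> x) * ?c x) - of_real (G x) * ?c x)"
        by (simp only:)
      also have "\<dots> = integral {0..1} (\<lambda>x. of_real (sqrt t) * (of_real (\<Theta> x) * ?c x)) - integral {0..1} (\<lambda>x. of_real (G x) * ?c x)"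
        by (intro Henstock_Kurzweil_Integration.integral_diff integrable_continuous_interval continuous_intros cont_\<Theta> cont_G)
      also have "integral {0..1} (\<lambda>x. of_real (sqrt t) * (of_real (\<Theta> x) * ?c x)) = of_real (sqrt t) * integral {0..1} (\<lambda>x. of_real (\<Theta> x) * ?c x)"
        by (rule Henstock_Kurzweil_Integration.integral_mult_right)
      also have "\<dots> - integral {0..1} (\<lambda>x. of_real (G x) * ?c x) = 0"
        unfolding \<Theta>_def G_def theta_fourier_coefficient[OF t] dual_fourier_coefficient[OF t]
        using t by simp
      finally show ?thesis .
    qed
  qed
  then have "sqrt t * \<Theta> x - G x = 0"
    unfolding D_def by (simp only: mult_eq_0_iff cis_neq_zero of_real_eq_0_iff simp_thms)
  then show ?thesis by (simp add: \<Theta>_def G_def)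
qed

corollary theta_functional_equation_deriv:
  assumes t: "t > 0" and x: "0 < x" "x < 1"
  shows "sqrt t * (\<Sum>n. theta_term' t n x) = (\<Sum>n. dual_term' t n x)"
proof (rule DERIV_unique)
  show "((\<lambda>x. \<Sum>n. dual_term t n x) has_real_derivative (\<Sum>n. dual_term' t n x)) (at x)"
    by (rule dual_has_derivative[OF t x])
  have "((\<lambda>x. sqrt t * (\<Sum>n. theta_term t n x)) has_real_derivative sqrt t * (\<Sum>n. theta_term' t n x)) (at x)"
    by (intro DERIV_cmult theta_has_derivative t x)
  then show "((\<lambda>x. \<Sum>n. dual_term t n x) has_real_derivative sqrt t * (\<Sum>n. theta_term' t n x)) (at x)"
    by (rule has_field_derivative_transform_within_open[where S = "{0<..<1}"])
       (use theta_functional_equation[OF t] x in auto)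
qed

section \<open>Loops meeting a circle\<close>

lemma Loop_top_of_set: "Loop (top_of_set S) = {\<gamma> \<in> Loop euclidean. \<gamma> \<subseteq> S}"
proof -
  have "subtopology (top_of_set S) \<gamma> = top_of_set \<gamma>" if "\<gamma> \<subseteq> S" for \<gamma>
    using that by (simp add: subtopology_subtopology inf.absorb2)
  then show ?thesis
    by (auto simp: Loop_def compactin_subtopology)
qed

lemma Loop1_eq: "Loop1 S = {\<gamma> \<in> Loop euclidean. \<gamma> \<subseteq> S \<and> 0 \<in> inside \<gamma>}"
  by (auto simp: Loop1_def Loop_top_of_set)

lemma Loop1_mono: "S \<subseteq> T \<Longrightarrow> Loop1 S \<subseteq> Loop1 T"
  by (auto simp: Loop1_eq)

lemma connected_space_top_of_set_iff: "connected_space (top_of_set S) \<longleftrightarrow> connected S"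
  using connectedin_def[of euclidean S] by simp

lemma loop_compact_connected:
  fixes \<gamma> :: "complex set"
  assumes "\<gamma> \<in> Loop euclidean"
  shows "compact \<gamma>" "connected \<gamma>"
proof -
  have h: "top_of_set \<gamma> homeomorphic_space top_of_set (sphere (0::complex) 1)"
    and "compact \<gamma>"
    using assms by (auto simp: Loop_def)
  show "compact \<gamma>" by fact
  have "connected_space (top_of_set (sphere (0::complex) 1))"
    by (simp add: connected_space_top_of_set_iff connected_sphere)
  with h show "connected \<gamma>"
    using homeomorphic_connected_space[OF h] by (simp add: connected_space_top_of_set_iff)
qed

section \<open>The Vietoris topology and measurability\<close>

lemma openin_vietoris_subset: "openin X U \<Longrightarrow> openin (vietoris X) {K. compactin X K \<and> K \<subseteq> U}"
  unfolding vietoris_def by (rule topology_generated_by_Basis) auto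

lemma openin_loop_topology_subset:
  assumes "openin X U" shows "openin (loop_topology X) {\<gamma> \<in> Loop X. \<gamma> \<subseteq> U}"
proof -
  have "{\<gamma> \<in> Loop X. \<gamma> \<subseteq> U} = {K. compactin X K \<and> K \<subseteq> U} \<inter> Loop X"
    by (auto simp: Loop_def)
  then show ?thesis
    unfolding loop_topology_def openin_subtopology using openin_vietoris_subset[OF assms] by blast
qed

lemma openin_borel_of: "openin X U \<Longrightarrow> U \<in> sets (borel_of X)"
  unfolding borel_of_def
  by (subst sets_measure_of) (auto dest: openin_subset intro: sigma_sets.Basic)

text \<open>Surrounding a point is not an open condition: a loop is a limit of thin loops that follow it
  but leave a gap.  Not surrounding it is one, which still makes both measurable.\<close>

lemma openin_loop_topology_outside:
  "openin (loop_topology euclidean) {\<gamma> \<in> Loop euclidean. (z::complex) \<in> outside \<gamma>}"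
proof (subst openin_subopen, intro ballI)
  fix \<gamma> assume "\<gamma> \<in> {\<gamma> \<in> Loop euclidean. z \<in> outside \<gamma>}"
  then have \<gamma>: "\<gamma> \<in> Loop euclidean" "z \<in> outside \<gamma>" by auto
  obtain R where R: "\<gamma> \<subseteq> ball 0 R" "R > 0"
    using loop_compact_connected(1)[OF \<gamma>(1)] compact_imp_bounded bounded_subset_ballD by blast
  have op: "open (- \<gamma>)"
    using loop_compact_connected(1)[OF \<gamma>(1)] compact_imp_closed by blast
  have "\<not> bounded (connected_component_set (- \<gamma>) z)"
    using \<gamma>(2) by (auto simp: outside_def)
  then obtain w where w: "w \<in> connected_component_set (- \<gamma>) z" "norm w \<ge> R"
    unfolding bounded_iff by (meson linear)
  then have "path_component (- \<gamma>) z w"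
    using open_path_connected_component[OF op] by simp
  then obtain p where p: "path p" "path_image p \<subseteq> - \<gamma>" "pathstart p = z" "pathfinish p = w"
    by (auto simp: path_component_def)
  \<comment> \<open>\<open>V\<close> excludes a path from \<open>z\<close> to a point
    \<open>w\<close> beyond the ball. For every loop inside \<open>V\<close> this path still joins
    \<open>z\<close> to the exterior of the ball, which is connected, unbounded and disjoint from
    the loop, so \<open>z\<close> stays outside.\<close>
  define V where "V = ball 0 R - path_image p"
  have "open V"
    unfolding V_def using p(1) by (intro open_Diff) (auto simp: closed_path_image)
  then have "openin (loop_topology euclidean) {\<gamma> \<in> Loop euclidean. \<gamma> \<subseteq> V}"
    by (intro openin_loop_topology_subset) simp
  moreover have "\<gamma> \<in> {\<gamma> \<in> Loop euclidean. \<gamma> \<subseteq> V}"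
    using \<gamma> R p by (auto simp: V_def)
  moreover have "z \<in> outside \<delta>" if "\<delta> \<subseteq> V" for \<delta>
  proof -
    have zw: "connected_component (- \<delta>) z w"
      unfolding connected_component_def
    proof (intro exI conjI)
      show "connected (path_image p)" by (simp add: p(1) connected_path_image)
      show "path_image p \<subseteq> - \<delta>" using that by (auto simp: V_def)
      show "z \<in> path_image p" using p(3) pathstart_in_path_image by blast
      show "w \<in> path_image p" using p(4) pathfinish_in_path_image by blast
    qed
    have "- ball 0 R \<subseteq> connected_component_set (- \<delta>) w"
    proof (rule connected_component_maximal)
      show "w \<in> - ball 0 R" using w(2) by simp
      show "connected (- ball (0::complex) R)"
        using connected_complement_bounded_convex[of "ball (0::complex) R"] by simp
      show "- ball 0 R \<subseteq> - \<delta>" using that by (auto simp: V_def)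
    qed
    moreover have "connected_component_set (- \<delta>) w = connected_component_set (- \<delta>) z"
      using zw connected_component_eq by blast
    moreover have "\<not> bounded (- ball (0::complex) R)"
      by (simp add: cobounded_imp_unbounded)
    ultimately have "\<not> bounded (connected_component_set (- \<delta>) z)"
      by (metis bounded_subset)
    then show ?thesis
      using zw connected_component_in(1) by (fastforce simp: outside_def)
  qed
  ultimately show "\<exists>T. openin (loop_topology euclidean) T \<and> \<gamma> \<in> T \<and>
      T \<subseteq> {\<gamma> \<in> Loop euclidean. z \<in> outside \<gamma>}"
    by (intro exI[of _ "{\<gamma> \<in> Loop euclidean. \<gamma> \<subseteq> V}"]) blast
qed

lemma inside_loops_measurable:
  assumes "open U"
  shows "{\<gamma> \<in> Loop euclidean. \<gamma> \<subseteq> U \<and> (z::complex) \<in> inside \<gamma>} \<in> sets (borel_of (loop_topology euclidean))"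
proof -
  \<comment> \<open>A point off the loop is either inside or outside it.\<close>
  have "{\<gamma> \<in> Loop euclidean. \<gamma> \<subseteq> U \<and> z \<in> inside \<gamma>} =
     {\<gamma> \<in> Loop euclidean. \<gamma> \<subseteq> U} \<inter> {\<gamma> \<in> Loop euclidean. \<gamma> \<subseteq> - {z}} - {\<gamma> \<in> Loop euclidean. z \<in> outside \<gamma>}"
    by (auto simp: inside_outside outside_def inside_def)
  also have "\<dots> \<in> sets (borel_of (loop_topology euclidean))"
    by (intro sets.Diff sets.Int openin_borel_of openin_loop_topology_outside openin_loop_topology_subset)
       (auto simp: assms)
  finally show ?thesis .
qed

section \<open>The plane as a surface and its dilations\<close>

lemma riemann_surface_plane: "riemann_surface plane"
proof -
  have "connected_space (euclidean :: complex topology)"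
    using connected_space_top_of_set_iff[of "UNIV :: complex set"] by (simp add: connected_UNIV)
  moreover have "inv_into UNIV id = (id :: complex \<Rightarrow> complex)"
    by (simp add: inv_id)
  ultimately show ?thesis
    by (simp add: riemann_surface_def plane_def Hausdorff_space_euclidean)
qed

lemma conformal_embedding_scale:
  "(c::complex) \<noteq> 0 \<Longrightarrow> conformal_embedding plane plane ((*) c)"
  by (auto simp: conformal_embedding_def plane_def inj_on_def o_def id_def intro!: holomorphic_intros continuous_intros)


lemma Loop1_scale:
  assumes c: "c > 0" and \<gamma>: "\<gamma> \<in> Loop1 (UNIV - {0})"
  shows "(*) (complex_of_real c) ` \<gamma> \<in> Loop1 (UNIV - {0})"
proof -
  let ?f = "(*) (complex_of_real c)" and ?g = "(*) (complex_of_real (1 / c))"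
  have \<gamma>: "\<gamma> \<in> Loop euclidean" "0 \<notin> \<gamma>" "bounded (connected_component_set (- \<gamma>) 0)"
    using \<gamma> by (simp_all add: Loop1_eq inside_def)
  have fg: "?f (?g z) = z" for z
    using c by simp
  have "continuous_on S ?f" "continuous_on S ?g" for S
    by (intro continuous_intros)+
  then have "homeomorphic_maps (top_of_set (?f ` \<gamma>)) (top_of_set \<gamma>) ?g ?f"
    unfolding homeomorphic_maps_def using c by (simp add: Pi_iff)
  then have "top_of_set (?f ` \<gamma>) homeomorphic_space top_of_set \<gamma>"
    unfolding homeomorphic_space_def by (intro exI)
  moreover have "top_of_set \<gamma> homeomorphic_space top_of_set (sphere (0::complex) 1)"
    using \<gamma>(1) by (simp add: Loop_def)
  ultimately have "top_of_set (?f ` \<gamma>) homeomorphic_space top_of_set (sphere (0::complex) 1)"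
    by (rule homeomorphic_space_trans)
  moreover have "compact (?f ` \<gamma>)"
    using loop_compact_connected(1)[OF \<gamma>(1)] by (intro compact_continuous_image continuous_intros)
  ultimately have "?f ` \<gamma> \<in> Loop euclidean"
    by (simp add: Loop_def)
  moreover have 0: "0 \<notin> ?f ` \<gamma>"
  proof
    assume "0 \<in> ?f ` \<gamma>"
    then obtain z where z: "0 = ?f z" "z \<in> \<gamma>" by (rule imageE)
    then have "z = 0" using c by simp
    with z(2) \<gamma>(2) show False by simp
  qed
  \<comment> \<open>Scaling back by \<open>1 / c\<close> sends the component of 0 in the complement
    of the image into the component of 0 in the complement of \<open>\<gamma>\<close>, which is
    bounded.\<close>
  moreover have "bounded (connected_component_set (- ?f ` \<gamma>) 0)" (is "bounded ?C")
  proof -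
    have "?g ` ?C \<subseteq> connected_component_set (- \<gamma>) 0"
    proof (rule connected_component_maximal)
      have "0 \<in> - ?f ` \<gamma>" using 0 by (subst Compl_iff)
      then have "0 \<in> ?C" by (intro CollectI connected_component_refl)
      then show "0 \<in> ?g ` ?C" by (rule rev_image_eqI) simp
      show "connected (?g ` ?C)"
        by (intro connected_continuous_image continuous_intros connected_connected_component)
      show "?g ` ?C \<subseteq> - \<gamma>"
      proof (intro subsetI ComplI)
        fix w assume "w \<in> ?g ` ?C" and "w \<in> \<gamma>"
        then obtain z where "z \<in> ?C" "w = ?g z" by (elim imageE)
        then have "z \<in> ?f ` \<gamma>" using fg[of z] \<open>w \<in> \<gamma>\<close> by (intro rev_image_eqI[of w]) simp_all
        moreover have "z \<in> - ?f ` \<gamma>"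
          using \<open>z \<in> ?C\<close> connected_component_subset by (rule subsetD[rotated])
        ultimately show False by simp
      qed
    qed
    with \<gamma>(3) have "bounded (?g ` ?C)"
      by (rule bounded_subset)
    then have "bounded (?f ` ?g ` ?C)"
      by (rule bounded_linear_image[OF _ bounded_linear_mult_right])
    moreover have "?f ` ?g ` ?C = ?C"
      using c by (simp add: image_image)
    ultimately show ?thesis by (simp only:)
  qed
  ultimately show ?thesis
    unfolding Loop1_eq inside_def by blast
qed

section \<open>Masses of loops around the origin\<close>

context
  fixes \<mu> :: "complex surface \<Rightarrow> complex set measure"
  assumes werner: "werner_family \<mu>"
begin

lemma sets_mu_plane: "sets (\<mu> plane) = sets (borel_of (loop_topology euclidean))"
  using werner riemann_surface_plane
  by (auto simp: werner_family_def loop_measure_family_def plane_def)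

lemma Loop1_measurable: "open (U :: complex set) \<Longrightarrow> Loop1 U \<in> sets (\<mu> plane)"
  unfolding Loop1_eq sets_mu_plane by (rule inside_loops_measurable)

lemma Loop1_hitting_measurable:
  assumes "open (U :: complex set)" "closed C"
  shows "{\<gamma> \<in> Loop1 U. \<gamma> \<inter> C \<noteq> {}} \<in> sets (\<mu> plane)"
proof -
  have "{\<gamma> \<in> Loop1 U. \<gamma> \<inter> C \<noteq> {}} = Loop1 U - Loop1 (U - C)"
    by (auto simp: Loop1_eq)
  then show ?thesis
    using assms by (simp only: sets.Diff Loop1_measurable open_Diff)
qed

lemma emeasure_mu0:
  assumes "A \<subseteq> Loop1 (UNIV - {0})"
  shows "emeasure (mu0 \<mu>) A = emeasure (\<mu> plane) A"
proof -
  have "Loop1 (UNIV - {0}) \<in> sets (\<mu> plane)"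
    by (intro Loop1_measurable open_Diff) auto
  then show ?thesis
    unfolding mu0_def using assms
    by (intro emeasure_restrict_space) (auto intro!: sets.Int)
qed

lemma Loop1_subset_punctured: "Loop1 U \<subseteq> Loop1 (UNIV - {0})"
  by (auto simp: Loop1_eq inside_def)

lemma emeasure_conformal_image:
  assumes "conformal_embedding plane plane f" "A \<in> sets (\<mu> plane)"
  shows "emeasure (\<mu> plane) ((`) f ` A) = emeasure (\<mu> plane) A"
proof -
  have "conformal_restriction \<mu>"
    using werner by (simp add: werner_family_def)
  from this[unfolded conformal_restriction_def, rule_format, OF conjI[OF riemann_surface_plane
      conjI[OF riemann_surface_plane assms(1)]] assms(2)]
  show ?thesis .
qed

text \<open>The dilation by \<open>r\<close> is a conformal embedding of the plane into itself, so
  conformal restriction becomes invariance of the measure; since the dilation is onto, it carries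
  one hitting event exactly to the other.\<close>

lemma circle_hitting_scale:
  assumes r: "r > 0"
  shows "emeasure (\<mu> plane) {\<gamma> \<in> Loop1 (UNIV - {0}). \<gamma> \<inter> {z. cmod z = r} \<noteq> {}} =
         emeasure (\<mu> plane) {\<gamma> \<in> Loop1 (UNIV - {0}). \<gamma> \<inter> {z. cmod z = 1} \<noteq> {}}"
proof -
  define H where "H s = {\<gamma> \<in> Loop1 (UNIV - {0}). \<gamma> \<inter> {z. cmod z = s} \<noteq> {}}" for s
  have H_scale: "(*) (of_real c) ` \<gamma> \<in> H (c * s)" if c: "c > 0" and \<gamma>: "\<gamma> \<in> H s" for c s :: real and \<gamma>
  proof -
    have "(*) (complex_of_real c) ` \<gamma> \<in> Loop1 (UNIV - {0})"
      using c \<gamma> by (intro Loop1_scale) (simp_all add: H_def)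
    moreover obtain z where "z \<in> \<gamma>" "cmod z = s"
      using \<gamma> by (auto simp: H_def)
    then have "of_real c * z \<in> (*) (of_real c) ` \<gamma>" "cmod (of_real c * z) = c * s"
      using c by (auto simp: norm_mult)
    ultimately show ?thesis unfolding H_def by blast
  qed
  have "(`) ((*) (of_real r)) ` H 1 = H r"
  proof (intro subset_antisym subsetI)
    fix \<gamma> assume "\<gamma> \<in> H r"
    then have "(*) (of_real (1 / r)) ` \<gamma> \<in> H (1 / r * r)"
      using r by (intro H_scale) simp_all
    then have *: "(*) (of_real (1 / r)) ` \<gamma> \<in> H 1"
      using r by simp
    have "\<gamma> = (*) (of_real r) ` (*) (of_real (1 / r)) ` \<gamma>"
      using r by (simp add: image_image)
    with * show "\<gamma> \<in> (`) ((*) (of_real r)) ` H 1"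
      by (rule rev_image_eqI)
  next
    fix \<gamma> assume "\<gamma> \<in> (`) ((*) (of_real r)) ` H 1"
    then obtain \<delta> where "\<delta> \<in> H 1" "\<gamma> = (*) (of_real r) ` \<delta>" by (rule imageE)
    then show "\<gamma> \<in> H r"
      using H_scale[of r \<delta> 1] r by simp
  qed
  moreover have "H 1 \<in> sets (\<mu> plane)"
    unfolding H_def by (intro Loop1_hitting_measurable open_Diff closed_Collect_eq continuous_intros) simp_all
  moreover have "conformal_embedding plane plane ((*) (complex_of_real r))"
    using r by (intro conformal_embedding_scale) simp
  ultimately have "emeasure (\<mu> plane) (H r) = emeasure (\<mu> plane) (H 1)"
    using emeasure_conformal_image by fastforce
  then show ?thesis unfolding H_def .
qed

text \<open>Werner's formula for the dilation of the unit disc onto the disc of radius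
  \<open>exp \<rho>\<close>, whose derivative has logarithm \<open>\<rho>\<close>. The additive form
  avoids subtracting masses in \<open>ennreal\<close>.\<close>

lemma unit_circle_hitting_in_ball:
  assumes \<rho>: "\<rho> > 0"
  shows "emeasure (\<mu> plane) {\<gamma> \<in> Loop1 (ball 0 (exp \<rho>)). \<gamma> \<inter> sphere 0 1 \<noteq> {}} + F0 \<mu> \<rho> = ennreal \<rho>"
proof -
  define R where "R = exp \<rho>"
  have R: "R > 1" using \<rho> by (simp add: R_def)
  let ?H = "{\<gamma> \<in> Loop1 (ball 0 R). \<gamma> \<inter> sphere 0 1 \<noteq> {}}"
  let ?An = "Loop1 {z. 1 < cmod z \<and> cmod z < R}"
  let ?W = "Loop1 (ball 0 R - {0}) - Loop (top_of_set (ball 0 1))"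
  have formula: "emeasure (mu0 \<mu>) (Loop1 (V - {0}) - Loop (top_of_set U)) = ennreal (ln (cmod (deriv \<phi> 0)))"
    if "open U" "simply_connected U" "open V" "simply_connected V" "0 \<in> U" "U \<subseteq> V" "V \<noteq> UNIV"
      "\<phi> holomorphic_on U" "bij_betw \<phi> U V" "\<phi> 0 = 0" for U V \<phi>
    using werner that unfolding werner_family_def werner_formula_def by blast
  have "((*) (complex_of_real R)) holomorphic_on ball 0 1"
    by (intro holomorphic_intros)
  moreover have "bij_betw ((*) (complex_of_real R)) (ball 0 1) (ball 0 R)"
    by (rule bij_betwI[where g = "\<lambda>z. z / complex_of_real R"])
       (use R in \<open>auto simp: norm_mult norm_divide field_simps\<close>)
  moreover have "ball (0::complex) R \<noteq> UNIV"
    by (metis bounded_ball not_bounded_UNIV)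
  ultimately have "emeasure (mu0 \<mu>) ?W = ennreal (ln (cmod (deriv ((*) (complex_of_real R)) 0)))"
    using R by (intro formula) (simp_all add: convex_imp_simply_connected subset_ball)
  also have "deriv ((*) (complex_of_real R)) 0 = complex_of_real R"
    by (intro DERIV_imp_deriv) (auto intro!: derivative_eq_intros)
  also have "ln (cmod (complex_of_real R)) = \<rho>"
    using R by (simp add: R_def)
  finally have "emeasure (\<mu> plane) ?W = ennreal \<rho>"
    using emeasure_mu0[OF order_trans[OF Diff_subset Loop1_subset_punctured]] by simp
  moreover have "?W = ?H \<union> ?An"
  proof -
    \<comment> \<open>A connected set with points both in the unit disc and off it must meet the
      frontier of the disc.\<close>
    have *: "\<gamma> \<inter> sphere 0 1 \<noteq> {} \<or> (\<forall>z\<in>\<gamma>. cmod z > 1)" if "\<gamma> \<in> Loop euclidean" "\<not> \<gamma> \<subseteq> ball 0 1" for \<gamma>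
    proof (rule ccontr)
      assume "\<not> ?thesis"
      then obtain z where z: "z \<in> \<gamma>" "cmod z < 1" and s: "\<gamma> \<inter> sphere 0 1 = {}"
        by (force simp: not_less)
      have "\<gamma> \<inter> frontier (ball 0 1) \<noteq> {}"
        by (rule connected_Int_frontier) (use that loop_compact_connected z in auto)
      with s show False by simp
    qed
    have "\<gamma> \<in> ?W \<longleftrightarrow> \<gamma> \<in> ?H \<union> ?An" if "\<gamma> \<in> Loop1 (ball 0 R)" for \<gamma>
    proof -
      have \<gamma>: "\<gamma> \<in> Loop euclidean" "\<gamma> \<subseteq> ball 0 R" "0 \<in> inside \<gamma>" "0 \<notin> \<gamma>"
        using that by (auto simp: Loop1_eq inside_def)
      have "\<gamma> \<subseteq> ball 0 1 \<longleftrightarrow> \<not> (\<gamma> \<inter> sphere 0 1 \<noteq> {} \<or> (\<forall>z\<in>\<gamma>. cmod z > 1))"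
      proof
        assume sub: "\<gamma> \<subseteq> ball 0 1"
        \<comment> \<open>The empty set would lie in the disc and vacuously satisfy the condition on
          moduli; it is excluded because it has empty inside.\<close>
        moreover have "\<gamma> \<noteq> {}" using \<gamma>(3) by auto
        ultimately show "\<not> (\<gamma> \<inter> sphere 0 1 \<noteq> {} \<or> (\<forall>z\<in>\<gamma>. cmod z > 1))"
          by fastforce
      qed (use *[OF \<gamma>(1)] in blast)
      moreover have "\<gamma> \<in> ?W \<longleftrightarrow> \<not> \<gamma> \<subseteq> ball 0 1"
        using \<gamma> by (auto simp: Loop1_eq Loop_top_of_set)
      moreover have "\<gamma> \<in> ?H \<longleftrightarrow> \<gamma> \<inter> sphere 0 1 \<noteq> {}"
        using that by blast
      moreover have "\<gamma> \<in> ?An \<longleftrightarrow> (\<forall>z\<in>\<gamma>. cmod z > 1)"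
        using \<gamma> by (auto simp: Loop1_eq)
      ultimately show ?thesis by blast
    qed
    moreover have "?W \<subseteq> Loop1 (ball 0 R)" "?H \<union> ?An \<subseteq> Loop1 (ball 0 R)"
      by (auto simp: Loop1_eq)
    ultimately show ?thesis by (intro subset_antisym subsetI) (meson subsetD)+
  qed
  moreover have "?H \<inter> ?An = {}"
    by (auto simp: Loop1_eq)
  moreover have "?An \<in> sets (\<mu> plane)"
    by (intro Loop1_measurable open_Collect_conj open_Collect_less continuous_intros)
  moreover have "?H \<in> sets (\<mu> plane)"
    by (intro Loop1_hitting_measurable) auto
  ultimately have "emeasure (\<mu> plane) ?H + emeasure (\<mu> plane) ?An = ennreal \<rho>"
    by (simp add: plus_emeasure)
  then show ?thesis
    using emeasure_mu0[OF Loop1_subset_punctured] by (simp add: F0_def R_def)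
qed

text \<open>Every loop is bounded, so the discs of radius \<open>exp n\<close> exhaust the event and
  continuity from below applies along integer \<open>\<rho> = n\<close>. Nonnegativity of
  \<open>f\<close> matters because \<open>ennreal\<close> clips negative numbers to 0: only with it
  does subtracting the annulus mass from \<open>n\<close> give \<open>n - f n\<close>.\<close>

lemma circle_hitting_limit:
  assumes r: "r > 0"
    and F: "\<And>\<rho>. \<rho> > 0 \<Longrightarrow> F0 \<mu> \<rho> = ennreal (f \<rho>)"
    and lim: "((\<lambda>\<rho>. \<rho> - f \<rho>) \<longlongrightarrow> c) at_top"
    and pos: "\<forall>\<^sub>F \<rho> in at_top. f \<rho> \<ge> 0"
  shows "emeasure (mu0 \<mu>) {\<gamma> \<in> Loop1 (UNIV - {0}). \<gamma> \<inter> {z. cmod z = r} \<noteq> {}} = ennreal c"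
proof -
  define H where "H n = {\<gamma> \<in> Loop1 (ball 0 (exp (real n))). \<gamma> \<inter> sphere 0 1 \<noteq> {}}" for n
  have "H n \<in> sets (\<mu> plane)" for n
    unfolding H_def by (intro Loop1_hitting_measurable) auto
  moreover have "incseq H"
  proof (rule monoI)
    fix m n :: nat assume "m \<le> n"
    then have "Loop1 (ball 0 (exp (real m))) \<subseteq> Loop1 (ball 0 (exp (real n)))"
      by (intro Loop1_mono subset_ball) simp
    then show "H m \<subseteq> H n" unfolding H_def by blast
  qed
  ultimately have "(\<lambda>n. emeasure (\<mu> plane) (H n)) \<longlonglongrightarrow> emeasure (\<mu> plane) (\<Union>n. H n)"
    by (intro Lim_emeasure_incseq) auto
  moreover have "(\<Union>n. H n) = {\<gamma> \<in> Loop1 (UNIV - {0}). \<gamma> \<inter> {z. cmod z = 1} \<noteq> {}}"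
  proof -
    have "\<exists>n. \<gamma> \<subseteq> ball 0 (exp (real n))" if \<gamma>: "\<gamma> \<in> Loop euclidean" for \<gamma> :: "complex set"
    proof -
      obtain B where B: "\<gamma> \<subseteq> ball 0 B"
        using loop_compact_connected(1)[OF \<gamma>] compact_imp_bounded bounded_subset_ballD by blast
      obtain n where "B \<le> real n" using real_arch_simple by blast
      also have "\<dots> \<le> exp (real n)" using exp_ge_add_one_self[of "real n"] by linarith
      finally show ?thesis using B subset_ball by blast
    qed
    moreover have "\<gamma> \<inter> sphere 0 1 = \<gamma> \<inter> {z. cmod z = 1}" for \<gamma> by auto
    ultimately show ?thesis
      by (auto simp: H_def Loop1_eq inside_def)
  qed
  moreover have "(\<lambda>n. emeasure (\<mu> plane) (H n)) \<longlonglongrightarrow> ennreal c"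
  proof -
    have "(\<lambda>n. ennreal (real n - f (real n))) \<longlonglongrightarrow> ennreal c"
      using filterlim_compose[OF lim filterlim_real_sequentially] by (rule tendsto_ennrealI)
    moreover have "\<forall>\<^sub>F n in sequentially. emeasure (\<mu> plane) (H n) = ennreal (real n - f (real n))"
      using eventually_compose_filterlim[OF pos filterlim_real_sequentially] eventually_gt_at_top[of 0]
    proof eventually_elim
      case (elim n)
      have "emeasure (\<mu> plane) (H n) = emeasure (\<mu> plane) (H n) + ennreal (f (real n)) - ennreal (f (real n))"
        by simp
      also have "emeasure (\<mu> plane) (H n) + ennreal (f (real n)) = ennreal (real n)"
        using unit_circle_hitting_in_ball[of "real n"] F[of "real n"] elim by (simp add: H_def)
      also have "ennreal (real n) - ennreal (f (real n)) = ennreal (real n - f (real n))"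
        using elim by (simp add: ennreal_minus)
      finally show ?case .
    qed
    ultimately show ?thesis using tendsto_cong by fast
  qed
  ultimately have "emeasure (\<mu> plane) {\<gamma> \<in> Loop1 (UNIV - {0}). \<gamma> \<inter> {z. cmod z = 1} \<noteq> {}} = ennreal c"
    using LIMSEQ_unique by fastforce
  moreover have "{\<gamma> \<in> Loop1 (UNIV - {0}). \<gamma> \<inter> {z. cmod z = r} \<noteq> {}} \<subseteq> Loop1 (UNIV - {0})"
    by blast
  ultimately show ?thesis
    using circle_hitting_scale[OF r] emeasure_mu0 by simp
qed

end

section \<open>Asymptotics of Cardy's formula\<close>

text \<open>The prefactor cancels the Gaussian weight at \<open>n = 0\<close> and leaves the
  exponents \<open>n^2 + n\<close>. For \<open>n \<ge> 1\<close> and \<open>pi / t \<ge> 1\<close>,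
  \<open>(n^2 + n) pi / t\<close> is at least \<open>n^2 + pi / t\<close>, so
  \<open>exp (- pi / t)\<close> splits off from a summable rest. The bound on \<open>c\<close> is
  chosen to admit the coefficients of the differentiated series as well as the cosines.\<close>

lemma dual_series_leading_term:
  fixes c :: "nat \<Rightarrow> real"
  assumes c: "\<And>n. \<bar>c n\<bar> \<le> 2 * pi * (2 * real n + 1)" and t: "0 < t" "t \<le> 1"
  shows "\<bar>exp (pi / (4 * t)) * (\<Sum>n. c n * exp (- (pi / t) * (real n + 1 / 2)\<^sup>2)) - c 0\<bar>
     \<le> exp (- pi / t) * (\<Sum>n. 240 * pi / (real n + 2)\<^sup>2)"
proof -
  define g where "g = (\<lambda>n. exp (pi / (4 * t)) * (c n * exp (- (pi / t) * (real n + 1 / 2)\<^sup>2)))"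
  have g: "g n = c n * exp (- (pi / t) * ((real n)\<^sup>2 + real n))" for n
  proof -
    have "pi / (4 * t) + - (pi / t) * (real n + 1 / 2)\<^sup>2 = - (pi / t) * ((real n)\<^sup>2 + real n)"
      using t by (simp add: field_simps power2_eq_square)
    then have "exp (pi / (4 * t)) * exp (- (pi / t) * (real n + 1 / 2)\<^sup>2) = exp (- (pi / t) * ((real n)\<^sup>2 + real n))"
      by (simp only: exp_add[symmetric])
    then show ?thesis by (simp add: g_def mult.left_commute)
  qed
  have sum': "summable (\<lambda>n. 240 * pi / (real n + 2)\<^sup>2)"
    using summable_ignore_initial_segment[OF summable_inverse_square[of "240 * pi"], of 1] by (simp add: add_ac)
  \<comment> \<open>The constant is \<open>240 = 4 * 20 * 3\<close>: \<open>4 pi (1 + m)\<close>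
    dominates the coefficient at \<open>m = n + 1\<close>, and \<open>gaussian_decay\<close> with
    \<open>a = 1\<close> contributes \<open>20 * (1 + 2)\<close>.\<close>
  have bound: "\<bar>g (Suc n)\<bar> \<le> exp (- pi / t) * (240 * pi / (real n + 2)\<^sup>2)" for n
  proof -
    let ?m = "real (Suc n)"
    have pt: "pi / t \<ge> 1" using t pi_gt3 by (simp add: field_simps)
    have "(?m\<^sup>2 + ?m - 1) * 1 \<le> (?m\<^sup>2 + ?m - 1) * (pi / t)"
      by (intro mult_left_mono pt) simp
    moreover have "?m\<^sup>2 \<le> ?m\<^sup>2 + ?m - 1" by simp
    moreover have "u + p \<le> (u + v) * p" if "(u + v - 1) * 1 \<le> (u + v - 1) * p" "u \<le> u + v - 1" for u v p :: real
      using that by (simp add: algebra_simps)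
    ultimately have "?m\<^sup>2 + pi / t \<le> (?m\<^sup>2 + ?m) * (pi / t)" by blast
    then have "exp (- (pi / t) * (?m\<^sup>2 + ?m)) \<le> exp (- pi / t + - 1 * ?m\<^sup>2)"
      by (simp add: mult.commute)
    also have "\<dots> = exp (- pi / t) * exp (- 1 * ?m\<^sup>2)"
      by (rule exp_add)
    finally have e: "exp (- (pi / t) * (?m\<^sup>2 + ?m)) \<le> exp (- pi / t) * exp (- 1 * ?m\<^sup>2)" .
    have "\<bar>g (Suc n)\<bar> = \<bar>c (Suc n)\<bar> * exp (- (pi / t) * (?m\<^sup>2 + ?m))"
      unfolding g by (simp add: abs_mult)
    also have "\<dots> \<le> (4 * pi * (1 + \<bar>?m\<bar>)) * (exp (- pi / t) * exp (- 1 * ?m\<^sup>2))"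
      using c[of "Suc n"] by (intro mult_mono e) (auto simp: algebra_simps intro: order_trans)
    also have "\<dots> = 4 * pi * exp (- pi / t) * ((1 + \<bar>?m\<bar>) * exp (- 1 * ?m\<^sup>2))"
      by (simp only: mult_ac)
    also have "\<dots> \<le> 4 * pi * exp (- pi / t) * (20 * (1 + 2 / 1\<^sup>2) / (real (Suc n) + 1)\<^sup>2)"
    proof (intro mult_left_mono gaussian_decay)
      have "5 * (1 + ?m\<^sup>2) - (?m + 1)\<^sup>2 = (2 * ?m - 1 / 2)\<^sup>2 + 15 / 4"
        by (simp add: power2_eq_square algebra_simps)
      then show "(?m + 1)\<^sup>2 \<le> 5 * (1 + ?m\<^sup>2)"
        using zero_le_power2[of "2 * ?m - 1 / 2"] by linarith
    qed auto
    finally show ?thesis by (simp add: algebra_simps)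
  qed
  have summable_tail: "summable (\<lambda>n. g (Suc n))"
    by (rule summable_comparison_test'[OF summable_mult[OF sum'], where N = 0]) (use bound in simp)
  then have summable_g: "summable g" by (simp only: summable_Suc_iff)
  have "exp (pi / (4 * t)) * (\<Sum>n. c n * exp (- (pi / t) * (real n + 1 / 2)\<^sup>2)) = suminf g"
  proof -
    have "summable (\<lambda>n. c n * exp (- (pi / t) * (real n + 1 / 2)\<^sup>2))"
      using summable_mult[OF summable_g, of "exp (- (pi / (4 * t)))"]
      by (simp add: g_def exp_minus mult.assoc[symmetric])
    then show ?thesis unfolding g_def by (rule suminf_mult[symmetric])
  qed
  also have "suminf g = (\<Sum>n. g (Suc n)) + c 0"
    using suminf_split_head[OF summable_g] g[of 0] by simp
  finally have "exp (pi / (4 * t)) * (\<Sum>n. c n * exp (- (pi / t) * (real n + 1 / 2)\<^sup>2)) - c 0 = (\<Sum>n. g (Suc n))"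
    by simp
  also have "\<bar>\<dots>\<bar> \<le> (\<Sum>n. exp (- pi / t) * (240 * pi / (real n + 2)\<^sup>2))"
    using norm_suminf_le[of "\<lambda>n. g (Suc n)", OF _ summable_mult[OF sum']] bound by simp
  also have "\<dots> = exp (- pi / t) * (\<Sum>n. 240 * pi / (real n + 2)\<^sup>2)"
    by (rule suminf_mult[OF sum'])
  finally show ?thesis .
qed

section \<open>Cardy's formula as a ratio of dual series\<close>

lemma infsum_int_eq_suminf:
  fixes f :: "int \<Rightarrow> real"
  assumes "summable (\<lambda>n. \<bar>f (int n)\<bar>)" "summable (\<lambda>n. \<bar>f (- int n - 1)\<bar>)"
  shows "(\<Sum>\<^sub>\<infinity>k. f k) = (\<Sum>n. f (int n) + f (- int n - 1))"
proof -
  have s: "summable (\<lambda>n. f (int n))" "summable (\<lambda>n. f (- int n - 1))"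
    by (rule summable_rabs_cancel[OF assms(1)] summable_rabs_cancel[OF assms(2)])+
  have "((\<lambda>n. f (int n)) has_sum (\<Sum>n. f (int n))) UNIV"
    using assms s by (intro norm_summable_imp_has_sum summable_sums) simp_all
  then have 1: "(f has_sum (\<Sum>n. f (int n))) (range int)"
    by (simp add: has_sum_reindex inj_on_def o_def)
  have "((\<lambda>n. f (- int n - 1)) has_sum (\<Sum>n. f (- int n - 1))) UNIV"
    using assms s by (intro norm_summable_imp_has_sum summable_sums) simp_all
  then have 2: "(f has_sum (\<Sum>n. f (- int n - 1))) (range (\<lambda>n. - int n - 1))"
    by (simp add: has_sum_reindex inj_on_def o_def)
  have "(f has_sum (\<Sum>n. f (int n)) + (\<Sum>n. f (- int n - 1))) (range int \<union> range (\<lambda>n. - int n - 1))"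
    by (rule has_sum_Un_disjoint[OF 1 2]) auto
  moreover have "k \<in> range int \<union> range (\<lambda>n. - int n - 1)" for k
  proof (cases "k \<ge> 0")
    case True
    then have "k = int (nat k)" by simp
    then show ?thesis by (intro UnI1) (rule range_eqI)
  next
    case False
    then have "k = - int (nat (- k - 1)) - 1" by simp
    then show ?thesis by (intro UnI2) (rule range_eqI)
  qed
  then have "range int \<union> range (\<lambda>n. - int n - 1) = UNIV" by (rule UNIV_eq_I[symmetric])
  ultimately have "(f has_sum (\<Sum>n. f (int n) + f (- int n - 1))) UNIV"
    using suminf_add[OF s] by simp
  then show ?thesis by (rule infsumI)
qed

text \<open>All exponents in Cardy's formula have the form \<open>3/2 u^2 - 1/24\<close> once
  squares are completed. This fixes \<open>t = 3 pi / \<rho>\<close>, and the factor coming from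
  \<open>- 1/24\<close> is common to numerator and denominator and cancels.\<close>

lemma nome_powr:
  assumes "\<rho> > 0"
  shows "exp (- 2 * pi\<^sup>2 / \<rho>) powr (3 / 2 * u\<^sup>2 - 1 / 24) =
    exp (pi\<^sup>2 / (12 * \<rho>)) * exp (- (pi * (3 * pi / \<rho>)) * u\<^sup>2)"
  using assms by (simp add: powr_def field_simps power2_eq_square flip: exp_add)

text \<open>The argument \<open>1/6\<close> is the centre of the parabola
  \<open>k (3 k - 1) / 2\<close>.\<close>

lemma cardy_denominator:
  assumes \<rho>: "\<rho> > 0"
  shows "(\<Prod>k. 1 - exp (- 2 * pi\<^sup>2 / \<rho>) ^ Suc k) =
    exp (pi\<^sup>2 / (12 * \<rho>)) * (\<Sum>n. theta_term (3 * pi / \<rho>) n (1 / 6))"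
proof -
  define q where "q = exp (- 2 * pi\<^sup>2 / \<rho>)"
  have q: "0 < q" "q < 1" using \<rho> by (simp_all add: q_def)
  have summable: "summable (\<lambda>n. theta_term (3 * pi / \<rho>) n (1 / 6))"
    by (rule summable_comparison_test'[OF summable_inverse_square, where N = 0])
       (use theta_term_le(1)[of "3 * pi / \<rho>" "1 / 6"] \<rho> in simp)
  have "(- 1) ^ n * (q powr (real n * (3 * real n - 1) / 2) - q powr ((real n + 1) * (3 * real n + 4) / 2)) =
     exp (pi\<^sup>2 / (12 * \<rho>)) * theta_term (3 * pi / \<rho>) n (1 / 6)" for n
  proof -
    have 1: "real n * (3 * real n - 1) / 2 = 3 / 2 * (1 / 6 - real n)\<^sup>2 - 1 / 24"
      and 2: "(real n + 1) * (3 * real n + 4) / 2 = 3 / 2 * (1 / 6 + real n + 1)\<^sup>2 - 1 / 24"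
      by (simp_all add: power2_eq_square field_simps)
    show ?thesis
      unfolding 1 2 q_def nome_powr[OF \<rho>] theta_term_def by (simp only: right_diff_distrib mult.left_commute)
  qed
  with pentagonal_number_theorem[OF q] show ?thesis
    using suminf_mult[OF summable] by (simp add: sums_iff q_def)
qed

text \<open>The centre of the parabola is now \<open>1/3\<close>. Writing the weight
  \<open>k\<close> as \<open>1/3 - (1/3 - k)\<close>, the first part gives a third of the theta
  series; the second is its derivative, since differentiating \<open>exp (- pi t (x - k)^2)\<close>
  brings down \<open>- 2 pi t (x - k)\<close>. The minus sign comes from \<open>k - 1\<close> in the
  power of \<open>- 1\<close>.\<close>

lemma cardy_numerator:
  assumes \<rho>: "\<rho> > 0"
  defines "t \<equiv> 3 * pi / \<rho>"
  shows "(\<Sum>\<^sub>\<infinity>k::int. (-1) powi (k - 1) * of_int k * exp (- 2 * pi\<^sup>2 / \<rho>) powr (3 * (of_int k)\<^sup>2 / 2 - of_int k + 1 / 8)) =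
    - exp (pi\<^sup>2 / (12 * \<rho>)) * ((\<Sum>n. theta_term t n (1 / 3)) / 3 + (\<Sum>n. theta_term' t n (1 / 3)) / (2 * pi * t))"
proof -
  have t: "t > 0" using \<rho> by (simp add: t_def)
  define Q where "Q = exp (pi\<^sup>2 / (12 * \<rho>))"
  define e1 where "e1 = (\<lambda>n. exp (- (pi * t) * (1 / 3 - real n)\<^sup>2))"
  define e2 where "e2 = (\<lambda>n. exp (- (pi * t) * (1 / 3 + real n + 1)\<^sup>2))"
  define f where "f = (\<lambda>k::int. (-1) powi (k - 1) * of_int k *
     exp (- 2 * pi\<^sup>2 / \<rho>) powr (3 * (of_int k)\<^sup>2 / 2 - of_int k + 1 / 8))"
  define M where "M = 20 * (1 + 2 / (pi * t)\<^sup>2)"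
  have exponent: "exp (- 2 * pi\<^sup>2 / \<rho>) powr (3 * k\<^sup>2 / 2 - k + 1 / 8) = Q * exp (- (pi * t) * (1 / 3 - k)\<^sup>2)" for k :: real
  proof -
    have "3 * k\<^sup>2 / 2 - k + 1 / 8 = 3 / 2 * (1 / 3 - k)\<^sup>2 - 1 / 24"
      by (simp add: power2_eq_square field_simps)
    then show ?thesis using nome_powr[OF \<rho>] by (simp only: Q_def t_def)
  qed
  have f1: "f (int n) = - Q * ((- 1) ^ n * real n * e1 n)" for n
  proof -
    have "(-1) powi (int n - 1) = - ((- 1::real) ^ n)"
      by (simp add: power_int_diff)
    then show ?thesis unfolding f_def exponent e1_def by simp
  qed
  have f2: "f (- int n - 1) = - Q * ((- 1) ^ n * (real n + 1) * e2 n)" for n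
  proof -
    have "(-1::real) powi (- int n - 1 - 1) = (- 1) powi (- int n)"
      by (simp add: power_int_diff power_int_minus divide_inverse)
    also have "\<dots> = (- 1) ^ n"
      by (simp add: power_int_minus power_inverse[symmetric])
    finally have "(-1::real) powi (- int n - 1 - 1) = (- 1) ^ n" .
    moreover have "1 / 3 - real_of_int (- int n - 1) = 1 / 3 + real n + 1" by simp
    ultimately show ?thesis unfolding f_def exponent e2_def by (simp add: algebra_simps)
  qed
  have b: "e1 n \<le> M / (real n + 1)\<^sup>2" "\<bar>1 / 3 - real n\<bar> * e1 n \<le> M / (real n + 1)\<^sup>2"
    "\<bar>1 / 3 + real n + 1\<bar> * e2 n \<le> M / (real n + 1)\<^sup>2" for n
    using theta_term_bounds[OF t, of "1 / 3" n] by (simp_all add: e1_def e2_def M_def)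
  have "summable (\<lambda>n. \<bar>f (int n)\<bar>)"
  proof (rule summable_comparison_test'[where N = 0])
    show "summable (\<lambda>n. Q * (2 * M / (real n + 1)\<^sup>2))"
      by (intro summable_mult summable_inverse_square)
    have "real n * e1 n \<le> (1 + \<bar>1 / 3 - real n\<bar>) * e1 n" for n
      by (intro mult_right_mono) (auto simp: e1_def)
    also have "(1 + \<bar>1 / 3 - real n\<bar>) * e1 n = e1 n + \<bar>1 / 3 - real n\<bar> * e1 n" for n
      by (simp only: ring_distribs mult_1)
    also have "e1 n + \<bar>1 / 3 - real n\<bar> * e1 n \<le> M / (real n + 1)\<^sup>2 + M / (real n + 1)\<^sup>2" for n
      by (intro add_mono b)
    also have "M / (real n + 1)\<^sup>2 + M / (real n + 1)\<^sup>2 = 2 * M / (real n + 1)\<^sup>2" for n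
      by simp
    finally have "real n * e1 n \<le> 2 * M / (real n + 1)\<^sup>2" for n .
    then have "Q * (real n * e1 n) \<le> Q * (2 * M / (real n + 1)\<^sup>2)" for n
      by (intro mult_left_mono) (simp_all add: Q_def)
    moreover have "norm \<bar>f (int n)\<bar> = Q * (real n * e1 n)" for n
      unfolding f1 by (simp add: abs_mult power_abs Q_def e1_def)
    ultimately show "norm \<bar>f (int n)\<bar> \<le> Q * (2 * M / (real n + 1)\<^sup>2)" for n
      by (simp only:)
  qed
  moreover have "summable (\<lambda>n. \<bar>f (- int n - 1)\<bar>)"
  proof (rule summable_comparison_test'[where N = 0])
    show "summable (\<lambda>n. Q * (M / (real n + 1)\<^sup>2))"
      by (intro summable_mult summable_inverse_square)
    have "(real n + 1) * e2 n \<le> \<bar>1 / 3 + real n + 1\<bar> * e2 n" for n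
      by (intro mult_right_mono) (auto simp: e2_def)
    then have "(real n + 1) * e2 n \<le> M / (real n + 1)\<^sup>2" for n
      using b(3)[of n] order_trans by blast
    then have "Q * ((real n + 1) * e2 n) \<le> Q * (M / (real n + 1)\<^sup>2)" for n
      by (intro mult_left_mono) (simp_all add: Q_def)
    moreover have "norm \<bar>f (- int n - 1)\<bar> = Q * ((real n + 1) * e2 n)" for n
      unfolding f2 by (simp add: abs_mult power_abs Q_def e2_def)
    ultimately show "norm \<bar>f (- int n - 1)\<bar> \<le> Q * (M / (real n + 1)\<^sup>2)" for n
      by (simp only:)
  qed
  ultimately have "(\<Sum>\<^sub>\<infinity>k. f k) = (\<Sum>n. f (int n) + f (- int n - 1))"
    by (rule infsum_int_eq_suminf)
  also have "\<dots> = (\<Sum>n. - Q * (theta_term t n (1 / 3) / 3 + theta_term' t n (1 / 3) / (2 * pi * t)))"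
  proof (intro suminf_cong)
    fix n
    have 1: "theta_term' t n (1 / 3) / (2 * pi * t) = - ((- 1) ^ n * ((1 / 3 - real n) * e1 n - (1 / 3 + real n + 1) * e2 n))"
      using t by (simp add: theta_term'_def e1_def e2_def)
    have 2: "theta_term t n (1 / 3) = (- 1) ^ n * (e1 n - e2 n)"
      by (simp add: theta_term_def e1_def e2_def)
    show "f (int n) + f (- int n - 1) = - Q * (theta_term t n (1 / 3) / 3 + theta_term' t n (1 / 3) / (2 * pi * t))"
      unfolding f1 f2 1 2 by (simp add: field_simps)
  qed
  also have "\<dots> = - Q * ((\<Sum>n. theta_term t n (1 / 3)) / 3 + (\<Sum>n. theta_term' t n (1 / 3)) / (2 * pi * t))"
  proof -
    have "summable (\<lambda>n. theta_term t n (1 / 3))"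
      by (rule summable_comparison_test'[OF summable_inverse_square, where N = 0])
         (use theta_term_le(1)[OF t, of "1 / 3"] in simp)
    moreover have "summable (\<lambda>n. theta_term' t n (1 / 3))"
      by (rule summable_comparison_test'[OF summable_inverse_square, where N = 0])
         (use theta_term_le(2)[OF t, of "1 / 3"] in simp)
    ultimately show ?thesis
      by (intro sums_unique[symmetric] sums_mult sums_add sums_divide summable_sums)
  qed
  finally show ?thesis by (simp add: f_def Q_def)
qed

text \<open>Numerator and denominator are multiplied by \<open>sqrt t\<close>, for the functional
  equation, and by \<open>h\<close>, which undoes the exponential decay of the dual series, so that
  each factor has a finite limit. The weight \<open>\<rho> / (6 pi^2)\<close> is
  \<open>1 / (2 pi t)\<close>.\<close>

lemma cardy_eq_dual:
  assumes \<rho>: "\<rho> > 0"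
  defines "t \<equiv> 3 * pi / \<rho>"
  defines "h \<equiv> exp (pi / (4 * t))"
  shows "cardy \<rho> = - 6 * pi * ((h * (\<Sum>n. dual_term t n (1 / 3))) / 3 + \<rho> / (6 * pi\<^sup>2) * (h * (\<Sum>n. dual_term' t n (1 / 3)))) /
     (h * (\<Sum>n. dual_term t n (1 / 6)))"
proof -
  have t: "t > 0" using \<rho> by (simp add: t_def)
  define Q where "Q = exp (pi\<^sup>2 / (12 * \<rho>))"
  define A B C where "A = (\<Sum>n. theta_term t n (1 / 3))" and "B = (\<Sum>n. theta_term' t n (1 / 3))"
    and "C = (\<Sum>n. theta_term t n (1 / 6))"
  have "cardy \<rho> = 6 * pi * (- Q * (A / 3 + B / (2 * pi * t)) / (Q * C))"
    unfolding cardy_def Let_def cardy_denominator[OF \<rho>] cardy_numerator[OF \<rho>]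
    by (simp only: Q_def A_def B_def C_def t_def)
  also have "\<dots> = - 6 * pi * (A / 3 + \<rho> / (6 * pi\<^sup>2) * B) / C"
    using \<rho> by (simp add: Q_def t_def power2_eq_square)
  also have "\<dots> = - 6 * pi * ((h * (sqrt t * A)) / 3 + \<rho> / (6 * pi\<^sup>2) * (h * (sqrt t * B))) / (h * (sqrt t * C))"
  proof -
    have "(h * (sqrt t * A)) / 3 + \<rho> / (6 * pi\<^sup>2) * (h * (sqrt t * B)) = (h * sqrt t) * (A / 3 + \<rho> / (6 * pi\<^sup>2) * B)"
      by (simp add: algebra_simps)
    moreover have "h * sqrt t \<noteq> 0" using t by (simp add: h_def)
    ultimately show ?thesis
      by (simp only: mult.assoc[symmetric] mult_divide_mult_cancel_left mult.commute[of "- 6 * pi" "h * sqrt t"]) simp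
  qed
  also have "sqrt t * A = (\<Sum>n. dual_term t n (1 / 3))"
    unfolding A_def by (rule theta_functional_equation[OF t]) auto
  also have "sqrt t * B = (\<Sum>n. dual_term' t n (1 / 3))"
    unfolding B_def by (rule theta_functional_equation_deriv[OF t]) auto
  also have "sqrt t * C = (\<Sum>n. dual_term t n (1 / 6))"
    unfolding C_def by (rule theta_functional_equation[OF t]) auto
  finally show ?thesis .
qed

lemma tendsto_times_exp_third: "((\<lambda>\<rho>::real. \<rho> * exp (- \<rho> / 3) * K) \<longlongrightarrow> 0) at_top"
proof -
  have "filterlim (\<lambda>\<rho>::real. \<rho> / 3) at_top at_top"
    unfolding filterlim_at_top
  proof
    fix Z :: real
    show "\<forall>\<^sub>F \<rho> in at_top. Z \<le> \<rho> / 3"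
      using eventually_ge_at_top[of "3 * Z"] by (rule eventually_mono) simp
  qed
  from filterlim_compose[OF tendsto_power_div_exp_0[of 1] this]
  have 1: "((\<lambda>\<rho>::real. (\<rho> / 3) ^ 1 / exp (\<rho> / 3)) \<longlongrightarrow> 0) at_top" .
  have "((\<lambda>\<rho>. 3 * K * ((\<rho> / 3) ^ 1 / exp (\<rho> / 3))) \<longlongrightarrow> 3 * K * 0) at_top"
    by (intro tendsto_mult tendsto_const 1)
  also have "(\<lambda>\<rho>. 3 * K * ((\<rho> / 3) ^ 1 / exp (\<rho> / 3))) = (\<lambda>\<rho>. \<rho> * exp (- \<rho> / 3) * K)"
  proof
    fix \<rho> :: real
    have "exp (- \<rho> / 3) = 1 / exp (\<rho> / 3)"
      by (metis exp_minus inverse_eq_divide minus_divide_left)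
    then show "3 * K * ((\<rho> / 3) ^ 1 / exp (\<rho> / 3)) = \<rho> * exp (- \<rho> / 3) * K"
      by simp
  qed
  finally show ?thesis by (simp only: mult_zero_right)
qed

lemma cardy_asymptotics: "((\<lambda>\<rho>. \<rho> - cardy \<rho>) \<longlongrightarrow> 2 * pi / sqrt 3) at_top"
proof -
  define K where "K = (\<Sum>n. 240 * pi / (real n + 2)\<^sup>2)"
  define S where "S = (\<lambda>(c :: nat \<Rightarrow> real) \<rho>. exp (pi / (4 * (3 * pi / \<rho>))) *
     (\<Sum>n. c n * exp (- (pi / (3 * pi / \<rho>)) * (real n + 1 / 2)\<^sup>2)))"
  \<comment> \<open>Convergence alone would not suffice, because the derivative series is multiplied
    by \<open>\<rho>\<close>; the exponential error bound absorbs this factor.\<close>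
  have S: "((\<lambda>\<rho>. \<rho> * (S c \<rho> - c 0)) \<longlongrightarrow> 0) at_top" if c: "\<And>n. \<bar>c n\<bar> \<le> 2 * pi * (2 * real n + 1)" for c
  proof (rule Lim_null_comparison)
    show "((\<lambda>\<rho>. \<rho> * exp (- \<rho> / 3) * K) \<longlongrightarrow> 0) at_top"
      by (rule tendsto_times_exp_third)
    show "\<forall>\<^sub>F \<rho> in at_top. norm (\<rho> * (S c \<rho> - c 0)) \<le> \<rho> * exp (- \<rho> / 3) * K"
      \<comment> \<open>From \<open>3 * pi\<close> on, \<open>t = 3 pi / \<rho>\<close> is at most
        1.\<close>
      using eventually_ge_at_top[of "3 * pi"]
    proof eventually_elim
      case (elim \<rho>)
      then have \<rho>: "\<rho> > 0" using pi_gt_zero by linarith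
      have "\<bar>S c \<rho> - c 0\<bar> \<le> exp (- pi / (3 * pi / \<rho>)) * K"
        unfolding S_def K_def by (rule dual_series_leading_term[OF c]) (use \<rho> elim in auto)
      also have "- pi / (3 * pi / \<rho>) = - \<rho> / 3" using \<rho> by (simp add: field_simps)
      finally show ?case using \<rho> by (simp add: abs_mult mult.assoc)
    qed
  qed
  have S': "(S c \<longlongrightarrow> c 0) at_top" if c: "\<And>n. \<bar>c n\<bar> \<le> 2 * pi * (2 * real n + 1)" for c
  proof -
    have "((\<lambda>\<rho>. inverse \<rho> * (\<rho> * (S c \<rho> - c 0)) + c 0) \<longlongrightarrow> 0 * 0 + c 0) at_top"
      by (intro tendsto_intros S c tendsto_inverse_0_at_top filterlim_ident)
    moreover have "\<forall>\<^sub>F \<rho> in at_top. inverse \<rho> * (\<rho> * (S c \<rho> - c 0)) + c 0 = S c \<rho>"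
      using eventually_gt_at_top[of 0] by eventually_elim (simp flip: mult.assoc)
    ultimately have "(S c \<longlongrightarrow> 0 * 0 + c 0) at_top" by (rule Lim_transform_eventually)
    then show ?thesis by simp
  qed
  define a b c where "a = (\<lambda>n. 2 * cos ((2 * real n + 1) * pi * (1 / 3)))"
    and "b = (\<lambda>n. - 2 * ((2 * real n + 1) * pi) * sin ((2 * real n + 1) * pi * (1 / 3)))"
    and "c = (\<lambda>n. 2 * cos ((2 * real n + 1) * pi * (1 / 6)))"
  have cos_bound: "\<bar>2 * cos x\<bar> \<le> 2 * pi * (2 * real n + 1)" for x n
  proof -
    have "\<bar>2 * cos x\<bar> \<le> 2 * 1" unfolding abs_mult by (intro mult_mono) auto
    also have "\<dots> \<le> 2 * (pi * (2 * real n + 1))"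
      using pi_gt3 by (intro mult_left_mono) (auto simp: algebra_simps add_increasing2 intro: order_trans)
    finally show ?thesis by simp
  qed
  have a: "\<bar>a n\<bar> \<le> 2 * pi * (2 * real n + 1)" and c: "\<bar>c n\<bar> \<le> 2 * pi * (2 * real n + 1)" for n
    unfolding a_def c_def by (rule cos_bound)+
  have b: "\<bar>b n\<bar> \<le> 2 * pi * (2 * real n + 1)" for n
  proof -
    have "\<bar>b n\<bar> = 2 * pi * (2 * real n + 1) * \<bar>sin ((2 * real n + 1) * pi * (1 / 3))\<bar>"
      by (simp add: b_def abs_mult)
    also have "\<dots> \<le> 2 * pi * (2 * real n + 1) * 1"
      by (intro mult_left_mono abs_sin_le_one) simp
    finally show ?thesis by simp
  qed
  have vals: "a 0 = 1" "b 0 = - pi * sqrt 3" "c 0 = sqrt 3"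
    using cos_60 sin_60 cos_30 by (simp_all add: a_def b_def c_def)
  \<comment> \<open>Since \<open>b 0 / pi = - c 0\<close>, the parts of
    \<open>\<rho> * S b \<rho> / pi\<close> and \<open>\<rho> * S c \<rho>\<close> that grow
    linearly in \<open>\<rho>\<close> cancel, and both can be replaced by their deviations from the
    leading term.\<close>
  have lim: "((\<lambda>\<rho>. 2 * pi * S a \<rho> / S c \<rho> + ((\<rho> * (S b \<rho> - b 0)) / pi + \<rho> * (S c \<rho> - c 0)) / S c \<rho>)
      \<longlongrightarrow> 2 * pi * a 0 / c 0 + (0 / pi + 0) / c 0) at_top"
    by (intro tendsto_intros S S' a b c) (simp_all add: vals)
  have "\<forall>\<^sub>F \<rho> in at_top. S c \<rho> > 0"
    using S'[of c] c by (intro order_tendstoD(1)) (auto simp: vals)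
  then have "\<forall>\<^sub>F \<rho> in at_top. 2 * pi * S a \<rho> / S c \<rho> + ((\<rho> * (S b \<rho> - b 0)) / pi + \<rho> * (S c \<rho> - c 0)) / S c \<rho> = \<rho> - cardy \<rho>"
    using eventually_gt_at_top[of 0]
  proof eventually_elim
    case (elim \<rho>)
    have "cardy \<rho> = - 6 * pi * (S a \<rho> / 3 + \<rho> / (6 * pi\<^sup>2) * S b \<rho>) / S c \<rho>"
      using cardy_eq_dual[OF elim(2)] by (simp only: S_def a_def b_def c_def dual_term_def dual_term'_def)
    also have "- 6 * pi * (S a \<rho> / 3 + \<rho> / (6 * pi\<^sup>2) * S b \<rho>) = - (2 * pi * S a \<rho> + \<rho> * S b \<rho> / pi)"
      by (simp add: ring_distribs power2_eq_square)
    finally have "cardy \<rho> = - (2 * pi * S a \<rho> + \<rho> * S b \<rho> / pi) / S c \<rho>" .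
    moreover have "\<rho> * (S b \<rho> - b 0) / pi + \<rho> * (S c \<rho> - c 0) = \<rho> * S b \<rho> / pi + \<rho> * S c \<rho>"
      by (simp add: vals ring_distribs add_divide_distrib diff_divide_distrib)
    ultimately show ?case
      using elim(1) by (simp add: add_divide_distrib diff_divide_distrib)
  qed
  from Lim_transform_eventually[OF lim this] show ?thesis
    by (simp add: vals)
qed

theorem corollary1p3:
  fixes \<mu> :: "complex surface \<Rightarrow> complex set measure" and r :: real
  assumes werner: "werner_family \<mu>"
    and cardy: "\<And>\<rho>::real. \<rho> > 0 \<Longrightarrow> F0 \<mu> \<rho> = ennreal (cardy \<rho>)"
    and r: "r > 0"
  shows "emeasure (mu0 \<mu>) {\<gamma> \<in> Loop1 (UNIV - {0}). \<gamma> \<inter> {z. cmod z = r} \<noteq> {}} =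
    ennreal (2 * pi / sqrt 3)"
proof (rule circle_hitting_limit[OF werner r cardy cardy_asymptotics])
  \<comment> \<open>Since \<open>\<rho> - cardy \<rho>\<close> converges, it is eventually below its
    limit plus 1, so \<open>cardy \<rho>\<close> is nonnegative once \<open>\<rho>\<close> has
    passed that bound.\<close>
  have "\<forall>\<^sub>F \<rho> in at_top. \<rho> - cardy \<rho> < 2 * pi / sqrt 3 + 1"
    using cardy_asymptotics by (rule order_tendstoD) simp
  then show "\<forall>\<^sub>F \<rho> in at_top. cardy \<rho> \<ge> 0"
    using eventually_ge_at_top[of "2 * pi / sqrt 3 + 1"] by eventually_elim linarith
qed

end
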